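(* Let $T>0$, $p\ge 1$ with $T\le p$, and $\varepsilon>0$. Let $\varphi,\psi,f$ be such that $\varphi,\psi\in C([0,T];\mathcal D(\mathcal A))\cap C^1([0,T];L^2(0,\pi))$, $\varphi(T)=\psi(T)$, $f\in C([0,T]\times[0,T];L^2(0,\pi))$, and $f|_{D_1}$, $f|_{D_2}$ are of class $C^1$ with values in $L^2(0,\pi)$. Suppose the problem $$\begin{cases} u_t+u_s-\Delta u=f(x,t,s), & (x,t,s)\in[0,\pi]\times[0,T]\times[0,T],\\ u(0,t,s)=u(\pi,t,s)=0, & (t,s)\in[0,T]\times[0,T],\\ u(x,T,s)=\psi(x,s), & (x,s)\in[0,\pi]\times[0,T],\\ u(x,t,T)=\varphi(x,t), & (x,t)\in[0,\pi]\times[0,T],\end{cases}$$ admits a unique solution $u$, and that there are constants $C_1,C_2$ with $$\frac{\pi}{2}\sup_{(t,s)\in D_1}\sum_{n=1}^\infty e^{2(p+t-T)n^2}|u_n(t,s)|^2<C_1,\qquad \frac{\pi}{2}\sup_{(t,s)\in D_2}\sum_{n=1}^\infty e^{2(p+s-T)n^2}|u_n(t,s)|^2<C_2,$$ where $u_n(t,s)=\frac{2}{\pi}\int_0^\pi u(x,t,s)\sin(nx)\,dx$. Let $\varphi^\varepsilon,\psi^\varepsilon\in C([0,T];\mathcal D(\mathcal A))\cap C^1([0,T];L^2(0,\pi))$ be perturbed data satisfying $\|\psi^\varepsilon(\cdot,s)-\psi(\cdot,s)\|\le\varepsilon$ for all $s\in[0,T]$ and $\|\varphi^\varepsilon(\cdot,t)-\varphi(\cdot,t)\|\le\varepsilon$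 for all $t\in[0,T]$, and let $v^\varepsilon$ be the regularized solution corresponding to $(\varphi^\varepsilon,\psi^\varepsilon)$ (defined in the context). Then for every $(t,s)\in D_1$, $$\|v^\varepsilon(\cdot,t,s)-u(\cdot,t,s)\|\le(1+\sqrt{C_1})\,\varepsilon^{\frac{t-T+p}{p}},$$ and for every $(t,s)\in D_2$, $$\|v^\varepsilon(\cdot,t,s)-u(\cdot,t,s)\|\le(1+\sqrt{C_2})\,\varepsilon^{\frac{s-T+p}{p}}.$$
   Context: $\|\cdot\|$ is the norm of $L^2(0,\pi)$, $\|w\|^2=\int_0^\pi|w|^2dx$. $\mathcal A=-\Delta=-\frac{d^2}{dx^2}$ with $\mathcal D(\mathcal A)=H_0^1(0,\pi)\cap H^2(0,\pi)$ (graph norm). $D_1=\{(t,s):0\le s\le t\le T\}$, $D_2=\{(t,s):0\le t\le s\le T\}$. Functions of $x$ and time(s) are identified with $L^2(0,\pi)$-valued functions of the time variable(s). A solution means a function $u\in C([0,T]^2;\mathcal D(\mathcal A))\cap C^1([0,T]^2;L^2(0,\pi))$ satisfying the equation and the conditions. Coefficients: $\varphi^\varepsilon_n(t)=\frac2\pi\int_0^\pi\varphi^\varepsilon(x,t)\sin(nx)dx$, $\psi^\varepsilon_n(s)=\frac2\pi\int_0^\pi\psi^\varepsilon(x,s)\sin(nx)dx$, $f_n(t,s)=\frac2\pi\int_0^\pi f(x,t,s)\sin(nx)dx$. The regularized solution for the perturbed data is, for $(t,s)\in D_1$, $$v^\varepsilon(x,t,s)=\sum_{n\ge1}\left(\varepsilon+e^{-pn^2}\right)^{\frac{t-T}{p}}\left(\psi^\varepsilon_n(T+s-t)-\int_t^Te^{(t-\eta)n^2}f_n(T+t-\eta,T+s-\eta)\,d\eta\right)\sin(nx),$$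 and for $(t,s)\in D_2$, $$v^\varepsilon(x,t,s)=\sum_{n\ge1}\left(\varepsilon+e^{-pn^2}\right)^{\frac{s-T}{p}}\left(\varphi^\varepsilon_n(T+t-s)-\int_s^Te^{(s-\eta)n^2}f_n(T+t-\eta,T+s-\eta)\,d\eta\right)\sin(nx).$$ The first estimate of the claim concerns the $D_1$ formula and the second concerns the $D_2$ formula (including on the diagonal $t=s$). *)

theory Defs
  imports "HOL-Analysis.Analysis"
begin

section \<open>The space \<open>L\<^sup>2(0,\<pi>)\<close>\<close>

abbreviation M0 :: "real measure"
  where "M0 \<equiv> lebesgue_on {0<..<pi}"

definition sq_int :: "(real \<Rightarrow> real) \<Rightarrow> bool"
  where "sq_int f \<longleftrightarrow> f \<in> borel_measurable M0 \<and> integrable M0 (\<lambda>x. (f x)\<^sup>2)"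

definition ae_eq :: "(real \<Rightarrow> real) \<Rightarrow> (real \<Rightarrow> real) \<Rightarrow> bool"
  where "ae_eq f g \<longleftrightarrow> sq_int f \<and> sq_int g \<and> (AE x in M0. f x = g x)"

lemma sq_int_measurable: "sq_int f \<Longrightarrow> f \<in> borel_measurable M0"
  by (simp add: sq_int_def)

lemma sq_int_zero: "sq_int (\<lambda>x. 0)"
  by (simp add: sq_int_def)

lemma sq_int_mult:
  assumes "sq_int f" "sq_int g"
  shows "integrable M0 (\<lambda>x. f x * g x)"
proof (rule Bochner_Integration.integrable_bound)
  show "integrable M0 (\<lambda>x. (f x)\<^sup>2 + (g x)\<^sup>2)"
    using assms by (simp add: sq_int_def)
  show "(\<lambda>x. f x * g x) \<in> borel_measurable M0"
    using assms by (intro borel_measurable_times sq_int_measurable)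
  have "\<bar>a * b\<bar> \<le> a\<^sup>2 + b\<^sup>2" for a b :: real
  proof -
    have "0 \<le> (\<bar>a\<bar> - \<bar>b\<bar>)\<^sup>2" by simp
    hence "2 * (\<bar>a\<bar> * \<bar>b\<bar>) \<le> a\<^sup>2 + b\<^sup>2"
      by (simp add: power2_diff)
    thus ?thesis
      using mult_nonneg_nonneg[of "\<bar>a\<bar>" "\<bar>b\<bar>"] unfolding abs_mult by linarith
  qed
  thus "AE x in M0. norm (f x * g x) \<le> norm ((f x)\<^sup>2 + (g x)\<^sup>2)"
    by simp
qed

lemma sq_int_add:
  assumes "sq_int f" "sq_int g"
  shows "sq_int (\<lambda>x. f x + g x)"
  using assms sq_int_mult[OF assms] unfolding sq_int_def power2_sum
  by (auto simp: mult.assoc)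

lemma sq_int_scale: "sq_int f \<Longrightarrow> sq_int (\<lambda>x. c * f x)"
  by (auto simp: sq_int_def power_mult_distrib)

lemma sq_int_uminus: "sq_int f \<Longrightarrow> sq_int (\<lambda>x. - f x)"
  by (auto simp: sq_int_def)

lemma sq_int_diff: "sq_int f \<Longrightarrow> sq_int g \<Longrightarrow> sq_int (\<lambda>x. f x - g x)"
  using sq_int_add[OF _ sq_int_uminus] by fastforce

quotient_type lsq = "real \<Rightarrow> real" / partial: ae_eq
proof (rule part_equivpI)
  show "\<exists>x. ae_eq x x"
    by (rule exI[of _ "\<lambda>x. 0"]) (simp add: ae_eq_def sq_int_zero)
  show "symp ae_eq"
    by (auto simp: symp_def ae_eq_def)
  show "transp ae_eq"
  proof (rule transpI)
    fix f g h assume "ae_eq f g" "ae_eq g h"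
    moreover from this have "AE x in M0. f x = h x"
      unfolding ae_eq_def by (auto elim: AE_mp intro: AE_I2)
    ultimately show "ae_eq f h"
      by (simp add: ae_eq_def)
  qed
qed

text \<open>Junk value: \<open>lsq_of f = 0\<close> if \<open>f\<close> is not square integrable.\<close>

lift_definition lsq_of :: "(real \<Rightarrow> real) \<Rightarrow> lsq"
  is "\<lambda>f. if sq_int f then f else (\<lambda>x. 0)"
  by (auto simp: ae_eq_def sq_int_zero)

lemma AE_cong2:
  assumes "AE x in M. f x = f' x" "AE x in M. g x = g' x"
  shows "AE x in M. h (f x) (g x) = h (f' x) (g' x)"
  using assms by eventually_elim simp

instantiation lsq :: real_inner
begin

lift_definition zero_lsq :: lsq is "\<lambda>x. 0"
  by (simp add: ae_eq_def sq_int_zero)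

lift_definition plus_lsq :: "lsq \<Rightarrow> lsq \<Rightarrow> lsq" is "\<lambda>f g x. f x + g x"
  by (auto simp: ae_eq_def sq_int_add AE_cong2)

lift_definition minus_lsq :: "lsq \<Rightarrow> lsq \<Rightarrow> lsq" is "\<lambda>f g x. f x - g x"
  by (auto simp: ae_eq_def sq_int_diff AE_cong2)

lift_definition uminus_lsq :: "lsq \<Rightarrow> lsq" is "\<lambda>f x. - f x"
  by (auto simp: ae_eq_def sq_int_uminus)

lift_definition scaleR_lsq :: "real \<Rightarrow> lsq \<Rightarrow> lsq" is "\<lambda>c f x. c * f x"
  by (auto simp: ae_eq_def sq_int_scale)

lift_definition inner_lsq :: "lsq \<Rightarrow> lsq \<Rightarrow> real" is "\<lambda>f g. \<integral>x. f x * g x \<partial>M0"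
  by (intro integral_cong_AE borel_measurable_times)
     (auto simp: ae_eq_def AE_cong2 sq_int_measurable)

definition norm_lsq :: "lsq \<Rightarrow> real"
  where "norm_lsq w = sqrt (inner w w)"

definition sgn_lsq :: "lsq \<Rightarrow> lsq"
  where "sgn_lsq w = inverse (norm w) *\<^sub>R w"

definition dist_lsq :: "lsq \<Rightarrow> lsq \<Rightarrow> real"
  where "dist_lsq w z = norm (w - z)"

definition uniformity_lsq :: "(lsq \<times> lsq) filter"
  where "uniformity_lsq = (INF e\<in>{0<..}. principal {(x, y). dist x y < e})"

definition open_lsq :: "lsq set \<Rightarrow> bool"
  where "open_lsq U \<longleftrightarrow> (\<forall>x\<in>U. \<forall>\<^sub>F (x', y) in uniformity. x' = x \<longrightarrow> y \<in> U)"

instance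
proof
  fix a b c :: lsq and r q :: real and U :: "lsq set"
  show "a + b + c = a + (b + c)"
    by transfer (auto simp: ae_eq_def sq_int_add algebra_simps)
  show "a + b = b + a"
    by transfer (auto simp: ae_eq_def sq_int_add algebra_simps)
  show "0 + a = a"
    by transfer (auto simp: ae_eq_def)
  show "- a + a = 0"
    by transfer (auto simp: ae_eq_def sq_int_zero)
  show "a - b = a + - b"
    by transfer (auto simp: ae_eq_def sq_int_diff)
  show "r *\<^sub>R (a + b) = r *\<^sub>R a + r *\<^sub>R b"
    by transfer (auto simp: ae_eq_def sq_int_add sq_int_scale algebra_simps)
  show "(r + q) *\<^sub>R a = r *\<^sub>R a + q *\<^sub>R a"
    by transfer (auto simp: ae_eq_def sq_int_add sq_int_scale distrib_right)
  show "r *\<^sub>R q *\<^sub>R a = (r * q) *\<^sub>R a"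
    by transfer (auto simp: ae_eq_def sq_int_scale mult.assoc[symmetric])
  show "1 *\<^sub>R a = a"
    by transfer (auto simp: ae_eq_def)
  show "dist a b = norm (a - b)" by (rule dist_lsq_def)
  show "sgn a = inverse (norm a) *\<^sub>R a" by (rule sgn_lsq_def)
  show "uniformity = (INF e\<in>{0<..}. principal {(x, y :: lsq). dist x y < e})"
    by (rule uniformity_lsq_def)
  show "open U \<longleftrightarrow> (\<forall>x\<in>U. \<forall>\<^sub>F (x', y) in uniformity. x' = x \<longrightarrow> y \<in> U)"
    by (rule open_lsq_def)
  show "inner a b = inner b a"
    by transfer (simp add: mult.commute)
  show "inner (a + b) c = inner a c + inner b c"
    by transfer (simp add: ae_eq_def distrib_right sq_int_mult)
  show "inner (r *\<^sub>R a) b = r * inner a b"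
    by transfer (simp add: mult.assoc)
  show "0 \<le> inner a a"
    by transfer (simp add: integral_nonneg_AE)
  show "inner a a = 0 \<longleftrightarrow> a = 0"
  proof (transfer)
    fix f assume "ae_eq f f"
    hence f: "sq_int f" by (simp add: ae_eq_def)
    have "(\<integral>x. f x * f x \<partial>M0) = 0 \<longleftrightarrow> (AE x in M0. f x * f x = 0)"
      by (rule integral_nonneg_eq_0_iff_AE) (auto intro: sq_int_mult f)
    thus "(\<integral>x. f x * f x \<partial>M0) = 0 \<longleftrightarrow> ae_eq f (\<lambda>x. 0)"
      by (simp add: ae_eq_def f sq_int_zero)
  qed
  show "norm a = sqrt (inner a a)" by (rule norm_lsq_def)
qed

end

lemma inner_lsq_of:
  "sq_int f \<Longrightarrow> sq_int g \<Longrightarrow> inner (lsq_of f) (lsq_of g) = (\<integral>x. f x * g x \<partial>M0)"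
  by transfer simp

lemma norm_lsq_of: "sq_int f \<Longrightarrow> norm (lsq_of f) = sqrt (\<integral>x. (f x)\<^sup>2 \<partial>M0)"
  by (simp add: norm_lsq_def inner_lsq_of power2_eq_square)

lemma lsq_of_eq_iff:
  "sq_int f \<Longrightarrow> sq_int g \<Longrightarrow> lsq_of f = lsq_of g \<longleftrightarrow> (AE x in M0. f x = g x)"
  by transfer (simp add: ae_eq_def)

lemma lsq_of_surj: "\<exists>f. sq_int f \<and> lsq_of f = w"
  by transfer (auto simp: ae_eq_def)


section \<open>The operator \<open>-d\<^sup>2/dx\<^sup>2\<close> with domain \<open>H\<^sub>0\<^sup>1(0,\<pi>) \<inter> H\<^sup>2(0,\<pi>)\<close>\<close>

text \<open>\<open>C\<^sup>\<infinity>\<close> functions with compact support in \<open>(0,\<pi>)\<close>.\<close>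

definition test_fun :: "(real \<Rightarrow> real) \<Rightarrow> bool"
  where "test_fun \<phi> \<longleftrightarrow>
    (\<forall>k x. (deriv ^^ k) \<phi> differentiable (at x)) \<and>
    closure {x. \<phi> x \<noteq> 0} \<subseteq> {0<..<pi}"

definition weak_deriv :: "lsq \<Rightarrow> lsq \<Rightarrow> bool"
  where "weak_deriv w g \<longleftrightarrow>
    (\<forall>\<phi>. test_fun \<phi> \<longrightarrow> inner w (lsq_of (deriv \<phi>)) = - inner g (lsq_of \<phi>))"

definition H2 :: "lsq set"
  where "H2 = {w. \<exists>g h. weak_deriv w g \<and> weak_deriv g h}"

text \<open>The closure of the test functions in the \<open>H\<^sup>1\<close> norm.\<close>

definition H10 :: "lsq set"
  where "H10 = {w. \<exists>g. weak_deriv w g \<and>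
    (\<exists>\<phi> :: nat \<Rightarrow> real \<Rightarrow> real. (\<forall>k. test_fun (\<phi> k)) \<and>
      (\<lambda>k. lsq_of (\<phi> k)) \<longlonglongrightarrow> w \<and> (\<lambda>k. lsq_of (deriv (\<phi> k))) \<longlonglongrightarrow> g)}"

text \<open>Weak derivatives are unique as elements of \<open>L\<^sup>2(0,\<pi>)\<close>, so the choice operator
  selects the only candidate; outside \<open>H\<^sup>2\<close> the value is irrelevant.\<close>

definition laplacian :: "lsq \<Rightarrow> lsq"
  where "laplacian w = (SOME h. \<exists>g. weak_deriv w g \<and> weak_deriv g h)"

definition opA :: "lsq \<Rightarrow> lsq"
  where "opA w = - laplacian w"

definition domA :: "lsq set"
  where "domA = H10 \<inter> H2"


section \<open>Function classes\<close>

text \<open>\<open>C(S; \<D>(\<A>))\<close>: the graph norm of \<open>w\<close> is the norm of \<open>(w, \<A> w)\<close>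
  in \<open>L\<^sup>2 \<times> L\<^sup>2\<close>.\<close>

definition C0_domA :: "'a::topological_space set \<Rightarrow> ('a \<Rightarrow> lsq) \<Rightarrow> bool"
  where "C0_domA S u \<longleftrightarrow>
    (\<forall>z\<in>S. u z \<in> domA) \<and> continuous_on S (\<lambda>z. (u z, opA (u z)))"

text \<open>\<open>C\<^sup>1(S; L\<^sup>2(0,\<pi>))\<close>; used only for an interval, a square and triangles, all closed
  and with non-empty interior, where derivatives at boundary points are taken relative to \<open>S\<close>.\<close>

definition C1_lsq :: "'a::real_normed_vector set \<Rightarrow> ('a \<Rightarrow> lsq) \<Rightarrow> bool"
  where "C1_lsq S u \<longleftrightarrow>
    (\<exists>u' :: 'a \<Rightarrow> 'a \<Rightarrow>\<^sub>L lsq.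
      (\<forall>z\<in>S. (u has_derivative blinfun_apply (u' z)) (at z within S)) \<and>
      continuous_on S u')"

definition D1 :: "real \<Rightarrow> (real \<times> real) set"
  where "D1 T = {(t, s). 0 \<le> s \<and> s \<le> t \<and> t \<le> T}"

definition D2 :: "real \<Rightarrow> (real \<times> real) set"
  where "D2 T = {(t, s). 0 \<le> t \<and> t \<le> s \<and> s \<le> T}"


section \<open>The ultraparabolic problem\<close>

text \<open>A function in \<open>H\<^sup>2(0,\<pi>)\<close> has a continuous representative on \<open>[0,\<pi>]\<close>; boundary values
  are those of this representative.\<close>

definition dirichlet_bc :: "lsq \<Rightarrow> bool"
  where "dirichlet_bc w \<longleftrightarrow>
    (\<exists>g. continuous_on {0..pi} g \<and> sq_int g \<and> lsq_of g = w \<and> g 0 = 0 \<and> g pi = 0)"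

definition solution ::
  "real \<Rightarrow> (real \<times> real \<Rightarrow> lsq) \<Rightarrow> (real \<Rightarrow> lsq) \<Rightarrow> (real \<Rightarrow> lsq) \<Rightarrow> (real \<times> real \<Rightarrow> lsq) \<Rightarrow> bool"
  where "solution T f \<phi> \<psi> u \<longleftrightarrow>
    C0_domA ({0..T} \<times> {0..T}) u \<and> C1_lsq ({0..T} \<times> {0..T}) u \<and>
    (\<forall>t\<in>{0..T}. \<forall>s\<in>{0..T}.
      vector_derivative (\<lambda>\<tau>. u (\<tau>, s)) (at t within {0..T})
      + vector_derivative (\<lambda>\<sigma>. u (t, \<sigma>)) (at s within {0..T})
      - laplacian (u (t, s)) = f (t, s)) \<and>
    (\<forall>t\<in>{0..T}. \<forall>s\<in>{0..T}. dirichlet_bc (u (t, s))) \<and>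
    (\<forall>s\<in>{0..T}. u (T, s) = \<psi> s) \<and>
    (\<forall>t\<in>{0..T}. u (t, T) = \<phi> t)"

definition unique_solution ::
  "real \<Rightarrow> (real \<times> real \<Rightarrow> lsq) \<Rightarrow> (real \<Rightarrow> lsq) \<Rightarrow> (real \<Rightarrow> lsq) \<Rightarrow> (real \<times> real \<Rightarrow> lsq) \<Rightarrow> bool"
  where "unique_solution T f \<phi> \<psi> u \<longleftrightarrow>
    solution T f \<phi> \<psi> u \<and>
    (\<forall>w. solution T f \<phi> \<psi> w \<longrightarrow> (\<forall>z\<in>{0..T} \<times> {0..T}. w z = u z))"


section \<open>The regularized solution\<close>

definition sine :: "nat \<Rightarrow> lsq"
  where "sine n = lsq_of (\<lambda>x. sin (real n * x))"

text \<open>The inner product is \<open>\<integral>\<^sub>0\<^sup>\<pi> w(x) sin(nx) dx\<close>.\<close>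

definition sine_coeff :: "nat \<Rightarrow> lsq \<Rightarrow> real"
  where "sine_coeff n w = 2 / pi * inner w (sine n)"

text \<open>The \<open>n\<close>-th terms, for \<open>n \<ge> 1\<close>, of the series over the two triangles.\<close>

definition reg1_term ::
  "real \<Rightarrow> real \<Rightarrow> real \<Rightarrow> (real \<times> real \<Rightarrow> lsq) \<Rightarrow> (real \<Rightarrow> lsq) \<Rightarrow> real \<Rightarrow> real \<Rightarrow> nat \<Rightarrow> lsq"
  where "reg1_term T p \<epsilon> f \<psi> t s n =
    ((\<epsilon> + exp (- p * (real n)\<^sup>2)) powr ((t - T) / p)
      * (sine_coeff n (\<psi> (T + s - t))
         - integral {t..T} (\<lambda>\<eta>. exp ((t - \<eta>) * (real n)\<^sup>2)
             * sine_coeff n (f (T + t - \<eta>, T + s - \<eta>))))) *\<^sub>R sine n"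

definition reg2_term ::
  "real \<Rightarrow> real \<Rightarrow> real \<Rightarrow> (real \<times> real \<Rightarrow> lsq) \<Rightarrow> (real \<Rightarrow> lsq) \<Rightarrow> real \<Rightarrow> real \<Rightarrow> nat \<Rightarrow> lsq"
  where "reg2_term T p \<epsilon> f \<phi> t s n =
    ((\<epsilon> + exp (- p * (real n)\<^sup>2)) powr ((s - T) / p)
      * (sine_coeff n (\<phi> (T + t - s))
         - integral {s..T} (\<lambda>\<eta>. exp ((s - \<eta>) * (real n)\<^sup>2)
             * sine_coeff n (f (T + t - \<eta>, T + s - \<eta>))))) *\<^sub>R sine n"

definition reg1 ::
  "real \<Rightarrow> real \<Rightarrow> real \<Rightarrow> (real \<times> real \<Rightarrow> lsq) \<Rightarrow> (real \<Rightarrow> lsq) \<Rightarrow> real \<Rightarrow> real \<Rightarrow> lsq"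
  where "reg1 T p \<epsilon> f \<psi> t s = (\<Sum>k. reg1_term T p \<epsilon> f \<psi> t s (Suc k))"

definition reg2 ::
  "real \<Rightarrow> real \<Rightarrow> real \<Rightarrow> (real \<times> real \<Rightarrow> lsq) \<Rightarrow> (real \<Rightarrow> lsq) \<Rightarrow> real \<Rightarrow> real \<Rightarrow> lsq"
  where "reg2 T p \<epsilon> f \<phi> t s = (\<Sum>k. reg2_term T p \<epsilon> f \<phi> t s (Suc k))"

end

(* Along a characteristic direction (1, 1) the n-th sine coefficient of u solves the ODE
   y' = f_n - n^2 y, because cut-off sines are test functions and the cut-off error vanishes in
   the limit.  Hence the bracket in the regularized series for exact data is
   exp((t - T) n^2) u_n(t, s), and v - u splits into a data error, whose multiplier
   (eps + exp(-p n^2)) powr ((t - T) / p) is at most eps powr ((t - T) / p), and a bias with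
   multiplier (1 + x) powr (-a) - 1, where x = eps exp(p n^2) and a = (T - t) / p.  The latter is
   bounded by x / (1 + x) <= x powr (1 - a), which is eps powr (1 - a) times the weight in the
   hypothesis on u.  Both parts are then estimated by orthogonality of the sines. *)

theory Submission
  imports Defs
begin

section \<open>Continuous functions in \<open>L\<^sup>2(0,\<pi>)\<close>\<close>

text \<open>The operator is known only through weak derivatives tested against compactly supported
  functions, and neither the sines nor the cosines are such functions. If g is the weak derivative
  of w and h that of g, the two integrations by parts differ in kind. Pairing h with a sine works by
  cut-off: the slope of the cut-off blows up near the end points, but the sine vanishes there
  linearly. Pairing g with a cosine cannot be treated so, because the cosine does not vanish; there
  the approximation of w by test functions, granted by \<open>H10\<close>, carries the boundary
  condition. The other obstacle is the way back from coefficients to elements of L^2: u must be the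
  sum of its own sine series. For w in \<open>domA\<close> the coefficients decay like 1/n^2, so the
  series converges uniformly to some S, and w - S, being orthogonal to all sines, has to be tested
  only against w in \<open>H10\<close> and against S. The condition T <= p puts a into [0, 1], which
  is exactly where the bias is at most x / (1 + x).\<close>

lemma integrable_continuous_M0:
  fixes h :: "real \<Rightarrow> real"
  assumes "continuous_on {0..pi} h"
  shows "integrable M0 h"
proof -
  have "set_integrable lebesgue {0..pi} h"
    using assms by (rule absolutely_integrable_continuous_real)
  then have "set_integrable lebesgue {0<..<pi} h"
    by (rule set_integrable_subset) auto
  then show ?thesis
    by (simp add: integrable_restrict_space set_integrable_def)
qed

lemma integral_M0_eq:
  fixes h :: "real \<Rightarrow> real"
  assumes "continuous_on {0..pi} h"
  shows "(\<integral>x. h x \<partial>M0) = integral {0..pi} h"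
proof -
  have "(\<integral>x. h x \<partial>M0) = integral {0<..<pi} h"
    by (rule lebesgue_integral_eq_integral) (auto intro: integrable_continuous_M0 assms)
  then show ?thesis
    by (simp add: integral_open_interval_real)
qed

lemma sq_int_continuous:
  assumes "continuous_on {0..pi} h"
  shows "sq_int h"
  unfolding sq_int_def
  using integrable_continuous_M0[OF assms]
  by (auto intro!: integrable_continuous_M0 continuous_intros assms)

lemma lsq_of_add:
  "sq_int f \<Longrightarrow> sq_int g \<Longrightarrow> lsq_of (\<lambda>x. f x + g x) = lsq_of f + lsq_of g"
  by transfer (auto simp: ae_eq_def sq_int_add)

lemma lsq_of_diff:
  "sq_int f \<Longrightarrow> sq_int g \<Longrightarrow> lsq_of (\<lambda>x. f x - g x) = lsq_of f - lsq_of g"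
  by transfer (auto simp: ae_eq_def sq_int_diff)

lemma lsq_of_scale: "sq_int f \<Longrightarrow> lsq_of (\<lambda>x. c * f x) = c *\<^sub>R lsq_of f"
  by transfer (auto simp: ae_eq_def sq_int_scale)

lemma measure_M0: "measure M0 {0<..<pi} = pi"
  by (simp add: measure_restrict_space)

text \<open>The factor \<open>sqrt pi\<close> is the norm of the constant 1. Uniform approximation
  becomes approximation in L^2 through this bound.\<close>

lemma norm_lsq_of_le:
  assumes "continuous_on {0..pi} h" and "\<And>x. x \<in> {0<..<pi} \<Longrightarrow> \<bar>h x\<bar> \<le> e" and "0 \<le> e"
  shows "norm (lsq_of h) \<le> sqrt pi * e"
proof -
  have "(\<integral>x. (h x)\<^sup>2 \<partial>M0) \<le> (\<integral>x. e\<^sup>2 \<partial>M0)"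
  proof (rule integral_mono)
    show "integrable M0 (\<lambda>x. (h x)\<^sup>2)"
      by (intro integrable_continuous_M0 continuous_intros assms)
    show "integrable M0 (\<lambda>x. e\<^sup>2)"
      by (intro integrable_continuous_M0 continuous_intros)
    show "(h x)\<^sup>2 \<le> e\<^sup>2" if "x \<in> space M0" for x
      using that assms(2)[of x] by (simp add: abs_le_square_iff[symmetric] assms(3))
  qed
  also have "\<dots> = pi * e\<^sup>2"
    using measure_M0 by simp
  finally have "sqrt (\<integral>x. (h x)\<^sup>2 \<partial>M0) \<le> sqrt (pi * e\<^sup>2)"
    by simp
  then show ?thesis
    using assms by (simp add: norm_lsq_of sq_int_continuous real_sqrt_mult)
qed

text \<open>Dominated convergence with the constant \<open>(2 * B)\<^sup>2\<close>. The pointwise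
  limit is taken inside the open interval, since cut-off functions stay 0 at the end points.\<close>

lemma lsq_of_tendsto:
  assumes "\<And>k. continuous_on {0..pi} (F k)" and "continuous_on {0..pi} G"
    and "\<And>x. x \<in> {0<..<pi} \<Longrightarrow> (\<lambda>k. F k x) \<longlonglongrightarrow> G x"
    and "\<And>k x. x \<in> {0<..<pi} \<Longrightarrow> \<bar>F k x\<bar> \<le> B"
  shows "(\<lambda>k. lsq_of (F k)) \<longlonglongrightarrow> lsq_of G"
proof -
  have G: "\<bar>G x\<bar> \<le> B" if "x \<in> {0<..<pi}" for x
    using tendsto_rabs[OF assms(3)[OF that]] by (rule Lim_bounded) (use assms(4) that in auto)
  have "(\<lambda>k. \<integral>x. (F k x - G x)\<^sup>2 \<partial>M0) \<longlonglongrightarrow> (\<integral>x. 0 \<partial>M0)"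
  proof (rule integral_dominated_convergence)
    show "integrable M0 (\<lambda>x. (2 * B)\<^sup>2)"
      by (intro integrable_continuous_M0 continuous_intros)
    show "(\<lambda>x. (F k x - G x)\<^sup>2) \<in> borel_measurable M0" for k
      by (intro borel_measurable_integrable integrable_continuous_M0 continuous_intros assms)
    have "(\<lambda>k. (F k x - G x)\<^sup>2) \<longlonglongrightarrow> 0" if "x \<in> {0<..<pi}" for x
      using assms(3)[OF that] by (auto intro!: tendsto_eq_intros)
    then show "AE x in M0. (\<lambda>k. (F k x - G x)\<^sup>2) \<longlonglongrightarrow> 0"
      by (intro AE_I2) simp
    have "\<bar>F k x - G x\<bar> \<le> \<bar>2 * B\<bar>" if "x \<in> {0<..<pi}" for k x
      using assms(4)[OF that, of k] G[OF that] by linarith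
    then show "AE x in M0. norm ((F k x - G x)\<^sup>2) \<le> (2 * B)\<^sup>2" for k
      by (intro AE_I2) (simp add: abs_le_square_iff)
  qed auto
  then have "(\<lambda>k. sqrt (\<integral>x. (F k x - G x)\<^sup>2 \<partial>M0)) \<longlonglongrightarrow> 0"
    using tendsto_real_sqrt by fastforce
  moreover have "norm (lsq_of (F k) - lsq_of G) = sqrt (\<integral>x. (F k x - G x)\<^sup>2 \<partial>M0)" for k
    using assms(1,2)
    by (simp add: lsq_of_diff[symmetric] sq_int_continuous norm_lsq_of continuous_on_diff)
  ultimately have "(\<lambda>k. norm (lsq_of (F k) - lsq_of G)) \<longlonglongrightarrow> 0"
    by simp
  then show ?thesis
    by (simp add: LIM_zero_iff tendsto_norm_zero_iff)
qed

lemma inner_lsq_of_continuous: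
  assumes "continuous_on {0..pi} g" "continuous_on {0..pi} h"
  shows "inner (lsq_of g) (lsq_of h) = integral {0..pi} (\<lambda>x. g x * h x)"
  using assms by (simp add: inner_lsq_of sq_int_continuous integral_M0_eq continuous_on_mult)

section \<open>Cut-off functions\<close>

text \<open>For m = 0 this is the classical smooth function that is flat at 0. Larger m collect the
  powers of 1/y produced by differentiation, so the family is closed under derivatives up to linear
  combinations.\<close>

definition flat_exp :: "nat \<Rightarrow> real \<Rightarrow> real"
  where "flat_exp m y = (if y \<le> 0 then 0 else exp (- 1 / y) / y ^ m)"

text \<open>From the right, z = 1/y turns the function into z^m / exp z as z tends to
  infinity.\<close>

lemma flat_exp_tendsto_0: "(flat_exp m \<longlongrightarrow> 0) (at 0)"
proof -
  have "((\<lambda>y::real. exp (- 1 / y) / y ^ m) \<longlongrightarrow> 0) (at_right 0)"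
  proof -
    have "((\<lambda>z::real. z ^ m / exp z) \<longlongrightarrow> 0) at_top"
      by (rule tendsto_power_div_exp_0)
    from filterlim_compose[OF this filterlim_inverse_at_top_right]
    show ?thesis
      by (rule filterlim_cong[THEN iffD1, rotated -1])
        (auto simp: exp_minus field_simps eventually_at_right_field intro!: exI[of _ 1])
  qed
  then have "(flat_exp m \<longlongrightarrow> 0) (at_right 0)"
    by (rule Lim_transform_eventually)
      (auto simp: flat_exp_def eventually_at_right_field intro!: exI[of _ 1])
  moreover have "(flat_exp m \<longlongrightarrow> 0) (at_left 0)"
    by (rule Lim_transform_eventually[OF tendsto_const])
      (auto simp: flat_exp_def eventually_at_left_field intro!: exI[of _ "-1"])
  ultimately show ?thesis
    by (simp add: filterlim_split_at)
qed

lemma flat_exp_deriv: "(flat_exp m has_real_derivative flat_exp (m + 2) y - real m * flat_exp (Suc m) y) (at y)"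
proof (cases y "0::real" rule: linorder_cases)
  case less
  have "((\<lambda>y. 0) has_real_derivative 0) (at y)" by simp
  then have "(flat_exp m has_real_derivative 0) (at y)"
    by (rule has_field_derivative_transform_within_open[where S = "{..<0}"])
      (use less in \<open>auto simp: flat_exp_def\<close>)
  then show ?thesis using less by (simp add: flat_exp_def)
next
  case equal
  \<comment> \<open>On both sides of 0 the difference quotient is \<open>flat_exp (Suc m)\<close>
    itself.\<close>
  have "((\<lambda>h. (flat_exp m h - flat_exp m 0) / h) \<longlongrightarrow> 0) (at 0)"
    by (rule Lim_transform_eventually[OF flat_exp_tendsto_0[of "Suc m"]])
      (auto simp: flat_exp_def eventually_at intro!: exI[of _ 1])
  then show ?thesis using equal by (simp add: flat_exp_def has_field_derivative_iff)
next
  case greater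
  have "((\<lambda>y. exp (- 1 / y) / y ^ m) has_real_derivative flat_exp (m + 2) y - real m * flat_exp (Suc m) y) (at y)"
  \<comment> \<open>The split keeps the derivative of \<open>y ^ m\<close> free of a truncated
    exponent \<open>m - 1\<close>.\<close>
  proof (cases m)
    case 0
    then show ?thesis
      using greater
      by (auto intro!: derivative_eq_intros simp: flat_exp_def field_simps power2_eq_square)
  next
    case (Suc l)
    have "((\<lambda>y. exp (- 1 / y) / y ^ Suc l) has_real_derivative
        (exp (- 1 / y) * (1 / y\<^sup>2) * y ^ Suc l - exp (- 1 / y) * (real (Suc l) * y ^ l)) /
        (y ^ Suc l * y ^ Suc l)) (at y)"
      using greater by (intro DERIV_divide DERIV_chain2[OF DERIV_exp] DERIV_pow[THEN DERIV_cong])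
        (auto intro!: derivative_eq_intros simp: power2_eq_square)
    moreover have "(exp (- 1 / y) * (1 / y\<^sup>2) * y ^ Suc l - exp (- 1 / y) * (real (Suc l) * y ^ l)) /
        (y ^ Suc l * y ^ Suc l) = flat_exp (Suc l + 2) y - real (Suc l) * flat_exp (Suc (Suc l)) y"
      using greater by (simp add: flat_exp_def divide_simps power2_eq_square) (simp add: algebra_simps)
    ultimately show ?thesis using Suc by simp
  qed
  then show ?thesis
    by (rule has_field_derivative_transform_within_open[where S = "{0<..}"])
      (use greater in \<open>auto simp: flat_exp_def\<close>)
qed

text \<open>Closed under differentiation by construction, so smoothness needs no Leibniz formula.\<close>

inductive_set elem_smooth :: "(real \<Rightarrow> real) set" where
  const: "(\<lambda>x. c) \<in> elem_smooth"
| sin: "(\<lambda>x. sin (a * x + b)) \<in> elem_smooth"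
| flat_exp: "(\<lambda>x. flat_exp m (a * x + b)) \<in> elem_smooth"
| add: "f \<in> elem_smooth \<Longrightarrow> g \<in> elem_smooth \<Longrightarrow> (\<lambda>x. f x + g x) \<in> elem_smooth"
| mult: "f \<in> elem_smooth \<Longrightarrow> g \<in> elem_smooth \<Longrightarrow> (\<lambda>x. f x * g x) \<in> elem_smooth"

lemma elem_smooth_has_derivative:
  assumes "f \<in> elem_smooth"
  shows "\<exists>g\<in>elem_smooth. \<forall>x. (f has_real_derivative g x) (at x)"
  using assms
proof induction
  case (const c)
  then show ?case by (intro bexI[of _ "\<lambda>x. 0"] elem_smooth.const) auto
next
  case (sin a b)
  \<comment> \<open>Writing the cosine as a sine shifted by pi/2 keeps the derivative inside the
    class.\<close>
  have "((\<lambda>x. sin (a * x + b)) has_real_derivative a * sin (a * x + (b + pi / 2))) (at x)" for x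
    by (auto intro!: derivative_eq_intros simp: sin_add cos_add algebra_simps)
  then show ?case
    by (intro bexI[of _ "\<lambda>x. a * sin (a * x + (b + pi / 2))"] elem_smooth.mult elem_smooth.const
        elem_smooth.sin allI)
next
  case (flat_exp m a b)
  have "((\<lambda>x. flat_exp m (a * x + b)) has_real_derivative
      a * (flat_exp (m + 2) (a * x + b) + - real m * flat_exp (Suc m) (a * x + b))) (at x)" for x
    by (rule DERIV_chain2[OF flat_exp_deriv, THEN DERIV_cong, of "\<lambda>x. a * x + b" a])
      (auto intro!: derivative_eq_intros)
  then show ?case
    by (intro bexI[of _ "\<lambda>x. a * (flat_exp (m + 2) (a * x + b) + - real m * flat_exp (Suc m) (a * x + b))"]
        elem_smooth.mult elem_smooth.const elem_smooth.add elem_smooth.flat_exp allI)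
next
  case (add f g)
  then obtain f' g' where "f' \<in> elem_smooth" "g' \<in> elem_smooth"
    "\<forall>x. (f has_real_derivative f' x) (at x)" "\<forall>x. (g has_real_derivative g' x) (at x)"
    by blast
  then show ?case
    by (intro bexI[of _ "\<lambda>x. f' x + g' x"] elem_smooth.add allI DERIV_add) auto
next
  case (mult f g)
  then obtain f' g' where "f' \<in> elem_smooth" "g' \<in> elem_smooth"
    "\<forall>x. (f has_real_derivative f' x) (at x)" "\<forall>x. (g has_real_derivative g' x) (at x)"
    by blast
  then show ?case
    using mult by (intro bexI[of _ "\<lambda>x. f' x * g x + g' x * f x"]
      elem_smooth.add elem_smooth.mult allI DERIV_mult) auto
qed

lemma elem_smooth_deriv:
  assumes "f \<in> elem_smooth"
  shows "deriv f \<in> elem_smooth"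
proof -
  from elem_smooth_has_derivative[OF assms] obtain g where
    "g \<in> elem_smooth" "\<And>x. (f has_real_derivative g x) (at x)" by blast
  moreover from this have "deriv f = g" by (auto intro: DERIV_imp_deriv)
  ultimately show ?thesis by simp
qed

lemma elem_smooth_iterated_deriv: "f \<in> elem_smooth \<Longrightarrow> (deriv ^^ k) f \<in> elem_smooth"
  by (induction k) (auto intro: elem_smooth_deriv)

lemma elem_smooth_differentiable: "f \<in> elem_smooth \<Longrightarrow> f differentiable (at x)"
  using elem_smooth_has_derivative real_differentiable_def by blast

lemma elem_smooth_continuous_on: "f \<in> elem_smooth \<Longrightarrow> continuous_on A f"
  by (meson continuous_at_imp_continuous_on differentiable_imp_continuous_within
      elem_smooth_differentiable)

text \<open>The factors vanish within distance 1/(k + 1) of 0 and of pi respectively; in between the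
  product stays below 1 and tends to 1 as k grows. The arguments have the shape a x + b of the
  generators of \<open>elem_smooth\<close>.\<close>

definition cutoff :: "nat \<Rightarrow> real \<Rightarrow> real"
  where "cutoff k x = flat_exp 0 (real (Suc k) * x + - 1) * flat_exp 0 (- real (Suc k) * x + (real (Suc k) * pi - 1))"

lemma cutoff_smooth: "cutoff k \<in> elem_smooth"
  unfolding cutoff_def[abs_def] by (intro elem_smooth.mult elem_smooth.flat_exp)

lemma flat_exp0_bounds: "0 \<le> flat_exp 0 y" "flat_exp 0 y \<le> 1"
  by (auto simp: flat_exp_def)

lemma cutoff_bounds: "0 \<le> cutoff k x" "cutoff k x \<le> 1"
  unfolding cutoff_def by (intro mult_nonneg_nonneg mult_le_one flat_exp0_bounds)+

lemma test_fun_cutoff: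
  assumes "f \<in> elem_smooth"
  shows "test_fun (\<lambda>x. f x * cutoff k x)"
proof -
  let ?K = "real (Suc k)"
  have "{x. f x * cutoff k x \<noteq> 0} \<subseteq> {1 / ?K .. pi - 1 / ?K}"
  proof
    fix x assume "x \<in> {x. f x * cutoff k x \<noteq> 0}"
    then have "1 \<le> x * ?K" and "1 \<le> (pi - x) * ?K"
      by (auto simp: cutoff_def flat_exp_def algebra_simps split: if_splits)
    then have "1 / ?K \<le> x" and "1 / ?K \<le> pi - x"
      by (simp_all add: divide_le_eq del: of_nat_Suc)
    then show "x \<in> {1 / ?K .. pi - 1 / ?K}" by simp
  qed
  then have "closure {x. f x * cutoff k x \<noteq> 0} \<subseteq> {1 / ?K .. pi - 1 / ?K}"
    by (rule closure_minimal) simp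
  also have "\<dots> \<subseteq> {0<..<pi}"
  proof -
    have "0 < 1 / ?K" by simp
    moreover have "\<And>c x. 0 < c \<Longrightarrow> c \<le> x \<Longrightarrow> x \<le> pi - c \<Longrightarrow> 0 < x \<and> x < pi" by linarith
    ultimately show ?thesis by (metis atLeastAtMost_iff greaterThanLessThan_iff subsetI)
  qed
  finally show ?thesis
    unfolding test_fun_def
    by (intro conjI allI elem_smooth_differentiable elem_smooth_iterated_deriv elem_smooth.mult assms cutoff_smooth)
qed

section \<open>Pointwise limits of the cut-offs and of their slopes\<close>

lemma filterlim_affine_at_top:
  assumes "0 < x"
  shows "filterlim (\<lambda>k. real (Suc k) * x - c) at_top sequentially"
proof -
  have "filterlim (\<lambda>k. - c + x * real (Suc k)) at_top sequentially"
    by (intro filterlim_tendsto_add_at_top[OF tendsto_const]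
        filterlim_tendsto_pos_mult_at_top[OF tendsto_const assms]
        filterlim_compose[OF filterlim_real_sequentially filterlim_Suc])
  then show ?thesis by (simp add: algebra_simps)
qed

lemma flat_exp0_tendsto_1: "(flat_exp 0 \<longlongrightarrow> 1) at_top"
proof -
  have "((\<lambda>y::real. exp (- inverse y)) \<longlongrightarrow> exp (- 0)) at_top"
    by (intro tendsto_intros tendsto_inverse_0_at_top filterlim_ident)
  then have "((\<lambda>y::real. exp (- inverse y)) \<longlongrightarrow> 1) at_top" by simp
  then show ?thesis
    by (rule Lim_transform_eventually)
      (auto simp: flat_exp_def divide_inverse intro: eventually_mono[OF eventually_gt_at_top[of 0]])
qed

lemma cutoff_tendsto_1:
  assumes "x \<in> {0<..<pi}"
  shows "(\<lambda>k. cutoff k x) \<longlonglongrightarrow> 1"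
proof -
  have "(\<lambda>k. flat_exp 0 (real (Suc k) * x - 1) * flat_exp 0 (real (Suc k) * (pi - x) - 1)) \<longlonglongrightarrow> 1 * 1"
    using assms by (intro tendsto_mult filterlim_compose[OF flat_exp0_tendsto_1] filterlim_affine_at_top) auto
  then show ?thesis by (simp add: cutoff_def algebra_simps)
qed

text \<open>At \<open>y = K x - 1\<close> this bounds \<open>x\<close> times the \<open>x\<close>-derivative of the cut-off, so the
  derivative is harmless against a sine vanishing at the end points.\<close>

lemma flat_exp2_bound: "(y + 1) * flat_exp 2 y \<le> 3"
proof (cases "0 < y")
  case True
  define z where "z = 1 / y"
  have z: "0 < z" using True by (simp add: z_def)
  \<comment> \<open>With z = 1/y the claim becomes z + z^2 <= 3 exp z, which the quadratic Taylor
    bound gives with room to spare.\<close>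
  have e: "1 + z + z\<^sup>2 / 2 \<le> exp z"
    using exp_lower_Taylor_quadratic[of z] z by simp
  have "(y + 1) * flat_exp 2 y = (z + z\<^sup>2) / exp z"
    using True by (simp add: flat_exp_def z_def exp_minus field_simps power2_eq_square)
  also have "\<dots> \<le> 3"
  proof -
    have "0 \<le> z\<^sup>2" by simp
    with e z have "z + z\<^sup>2 \<le> 3 * exp z" by linarith
    then show ?thesis by (simp add: divide_le_eq)
  qed
  finally show ?thesis .
qed (simp add: flat_exp_def)

text \<open>For y = (k + 1) x - 1 the factor k + 1 equals (y + 1) / x, and
  \<open>flat_exp 2 y\<close> is at most 1/y^2 because exp(-1/y) <= 1; the product is therefore of
  order 1/y.\<close>

lemma flat_exp2_affine_tendsto_0:
  assumes "0 < x"
  shows "(\<lambda>k. real (Suc k) * flat_exp 2 (real (Suc k) * x - 1)) \<longlonglongrightarrow> 0"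
proof -
  have lim: "((\<lambda>y::real. ((y + 1) / x) * flat_exp 2 y) \<longlongrightarrow> 0) at_top"
  proof (rule tendsto_sandwich[OF _ _ tendsto_const])
    show "\<forall>\<^sub>F y in at_top. 0 \<le> ((y + 1) / x) * flat_exp 2 y"
      using assms by (auto simp: flat_exp_def intro: eventually_mono[OF eventually_gt_at_top[of 0]])
    show "\<forall>\<^sub>F y in at_top. ((y + 1) / x) * flat_exp 2 y \<le> (inverse y + inverse y * inverse y) / x"
    proof (rule eventually_mono[OF eventually_gt_at_top[of 0]])
      fix y :: real assume y: "0 < y"
      have "(y + 1) * flat_exp 2 y \<le> (y + 1) * (1 / y\<^sup>2)"
        using y by (intro mult_left_mono) (auto simp: flat_exp_def divide_right_mono)
      also have "\<dots> = inverse y + inverse y * inverse y"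
        using y by (simp add: field_simps power2_eq_square)
      finally show "((y + 1) / x) * flat_exp 2 y \<le> (inverse y + inverse y * inverse y) / x"
        using assms by (simp add: divide_right_mono)
    qed
    have "((\<lambda>y::real. (inverse y + inverse y * inverse y) / x) \<longlongrightarrow> (0 + 0 * 0) / x) at_top"
      using assms by (intro tendsto_intros tendsto_inverse_0_at_top filterlim_ident) auto
    then show "((\<lambda>y::real. (inverse y + inverse y * inverse y) / x) \<longlongrightarrow> 0) at_top" by simp
  qed
  have "(\<lambda>k. (real (Suc k) * x - 1 + 1) / x * flat_exp 2 (real (Suc k) * x - 1)) \<longlonglongrightarrow> 0"
    by (rule filterlim_compose[OF lim filterlim_affine_at_top[OF assms]])
  then show ?thesis using assms by simp
qed

text \<open>Linear vanishing at both end points is what compensates the slope of the cut-off. The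
  second bound follows from the first by the reflection x -> pi - x, which changes the sine by a
  sign only.\<close>

lemma abs_sin_mult_le:
  assumes "x \<in> {0<..<pi}"
  shows "\<bar>sin (real n * x)\<bar> \<le> real n * x" "\<bar>sin (real n * x)\<bar> \<le> real n * (pi - x)"
proof -
  show "\<bar>sin (real n * x)\<bar> \<le> real n * x"
    using abs_sin_x_le_abs_x[of "real n * x"] assms by simp
  have "sin (real n * x) = - (cos (real n * pi) * sin (real n * (pi - x)))"
  proof -
    have "sin (real n * x) = sin (real n * pi - real n * (pi - x))"
      by (simp add: algebra_simps)
    also have "\<dots> = - (cos (real n * pi) * sin (real n * (pi - x)))"
      by (simp add: sin_diff sin_npi del: cos_npi)
    finally show ?thesis .
  qed
  then have "\<bar>sin (real n * x)\<bar> = \<bar>sin (real n * (pi - x))\<bar>"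
    by (simp add: abs_mult)
  then show "\<bar>sin (real n * x)\<bar> \<le> real n * (pi - x)"
    using abs_sin_x_le_abs_x[of "real n * (pi - x)"] assms by simp
qed

lemma flat_exp0_deriv: "(flat_exp 0 has_real_derivative flat_exp 2 y) (at y)"
  using flat_exp_deriv[of 0 y] by (simp add: numeral_2_eq_2)

lemma cutoff_has_derivative:
  "(cutoff k has_real_derivative
      real (Suc k) * (flat_exp 2 (real (Suc k) * x - 1) * flat_exp 0 (real (Suc k) * (pi - x) - 1)
        - flat_exp 0 (real (Suc k) * x - 1) * flat_exp 2 (real (Suc k) * (pi - x) - 1))) (at x)"
proof -
  let ?K = "real (Suc k)"
  have 1: "((\<lambda>x. flat_exp 0 (?K * x + - 1)) has_real_derivative flat_exp 2 (?K * x + - 1) * ?K) (at x)"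
    by (rule DERIV_chain2[OF flat_exp0_deriv])
      (auto intro!: derivative_eq_intros simp del: of_nat_Suc)
  have 2: "((\<lambda>x. flat_exp 0 (- ?K * x + (?K * pi - 1))) has_real_derivative
      flat_exp 2 (- ?K * x + (?K * pi - 1)) * (- ?K)) (at x)"
    by (rule DERIV_chain2[OF flat_exp0_deriv])
      (auto intro!: derivative_eq_intros simp del: of_nat_Suc)
  have a: "- ?K * x + (?K * pi - 1) = ?K * (pi - x) - 1"
    by (simp add: algebra_simps)
  show ?thesis
    using DERIV_mult[OF 1 2] unfolding cutoff_def[abs_def] a
    by (rule DERIV_cong) (simp add: algebra_simps del: of_nat_Suc)
qed

lemma elem_smooth_sin_mult: "(\<lambda>x. sin (real n * x)) \<in> elem_smooth"
  using elem_smooth.sin[of "real n" 0] by simp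

lemma elem_smooth_cos_mult: "(\<lambda>x. cos (real n * x)) \<in> elem_smooth"
  using elem_smooth.sin[of "real n" "pi / 2"] by (simp add: sin_add)

section \<open>Cut-off sines and cosines as approximations in L^2\<close>

definition cosine :: "nat \<Rightarrow> lsq"
  where "cosine n = lsq_of (\<lambda>x. cos (real n * x))"

lemma elem_smooth_cutoff_tendsto:
  assumes "f \<in> elem_smooth" and "\<And>x. \<bar>f x\<bar> \<le> 1"
  shows "(\<lambda>k. lsq_of (\<lambda>x. f x * cutoff k x)) \<longlonglongrightarrow> lsq_of f"
proof (rule lsq_of_tendsto)
  show "continuous_on {0..pi} (\<lambda>x. f x * cutoff k x)" for k
    by (intro continuous_on_mult elem_smooth_continuous_on assms cutoff_smooth)
  show "continuous_on {0..pi} f"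
    by (intro elem_smooth_continuous_on assms)
  show "(\<lambda>k. f x * cutoff k x) \<longlonglongrightarrow> f x" if "x \<in> {0<..<pi}" for x
    using tendsto_mult[OF tendsto_const cutoff_tendsto_1[OF that], of "f x"] by simp
  show "\<bar>f x * cutoff k x\<bar> \<le> 1" for k x
    using assms(2)[of x] cutoff_bounds[of k x] by (simp add: abs_mult mult_le_one)
qed

lemma deriv_sin_cutoff:
  "deriv (\<lambda>x. sin (real n * x) * cutoff k x) x =
     real n * cos (real n * x) * cutoff k x + sin (real n * x) * real (Suc k) *
       (flat_exp 2 (real (Suc k) * x - 1) * flat_exp 0 (real (Suc k) * (pi - x) - 1)
        - flat_exp 0 (real (Suc k) * x - 1) * flat_exp 2 (real (Suc k) * (pi - x) - 1))"
proof (rule DERIV_imp_deriv)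
  have "((\<lambda>x. sin (real n * x)) has_real_derivative real n * cos (real n * x)) (at x)"
    by (auto intro!: derivative_eq_intros)
  from DERIV_mult[OF this cutoff_has_derivative]
  show "((\<lambda>x. sin (real n * x) * cutoff k x) has_real_derivative
     real n * cos (real n * x) * cutoff k x + sin (real n * x) * real (Suc k) *
       (flat_exp 2 (real (Suc k) * x - 1) * flat_exp 0 (real (Suc k) * (pi - x) - 1)
        - flat_exp 0 (real (Suc k) * x - 1) * flat_exp 2 (real (Suc k) * (pi - x) - 1))) (at x)"
    by (rule DERIV_cong) (simp add: algebra_simps del: of_nat_Suc)
qed

lemma flat_exp_nonneg: "0 \<le> flat_exp m y"
  by (simp add: flat_exp_def)

text \<open>Applied with c = n at x and, after reflection, at pi - x. Since (k + 1) x = y + 1 for y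
  = (k + 1) x - 1, the bound comes from \<open>flat_exp2_bound\<close> and is uniform in k.\<close>

lemma flat_exp2_affine_bound:
  assumes "0 \<le> c" and "\<bar>s\<bar> \<le> c * x"
  shows "\<bar>s\<bar> * (real (Suc k) * flat_exp 2 (real (Suc k) * x - 1)) \<le> 3 * c"
proof -
  let ?y = "real (Suc k) * x - 1"
  have "\<bar>s\<bar> * (real (Suc k) * flat_exp 2 ?y) \<le> c * x * (real (Suc k) * flat_exp 2 ?y)"
    using assms flat_exp_nonneg by (intro mult_right_mono mult_nonneg_nonneg) auto
  also have "\<dots> = c * ((?y + 1) * flat_exp 2 ?y)"
    by simp
  also have "\<dots> \<le> c * 3"
    by (intro mult_left_mono flat_exp2_bound assms)
  finally show ?thesis by simp
qed

text \<open>The product rule leaves two terms in which the sine meets the slope of the cut-off. They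
  tend to 0 at each interior point and are bounded uniformly in k, so dominated convergence removes
  them.\<close>

lemma deriv_sin_cutoff_tendsto:
  "(\<lambda>k. lsq_of (deriv (\<lambda>x. sin (real n * x) * cutoff k x))) \<longlonglongrightarrow> real n *\<^sub>R cosine n"
proof -
  have "(\<lambda>k. lsq_of (deriv (\<lambda>x. sin (real n * x) * cutoff k x))) \<longlonglongrightarrow>
      lsq_of (\<lambda>x. real n * cos (real n * x))"
  proof (rule lsq_of_tendsto)
    show "continuous_on {0..pi} (deriv (\<lambda>x. sin (real n * x) * cutoff k x))" for k
      by (intro elem_smooth_continuous_on elem_smooth_deriv elem_smooth.mult elem_smooth_sin_mult cutoff_smooth)
    show "continuous_on {0..pi} (\<lambda>x. real n * cos (real n * x))"
      by (intro continuous_intros)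
    fix x :: real assume x: "x \<in> {0<..<pi}"
    have lim: "(\<lambda>k. real (Suc k) * flat_exp 2 (real (Suc k) * x - 1)) \<longlonglongrightarrow> 0"
      "(\<lambda>k. real (Suc k) * flat_exp 2 (real (Suc k) * (pi - x) - 1)) \<longlonglongrightarrow> 0"
      "(\<lambda>k. flat_exp 0 (real (Suc k) * x - 1)) \<longlonglongrightarrow> 1"
      "(\<lambda>k. flat_exp 0 (real (Suc k) * (pi - x) - 1)) \<longlonglongrightarrow> 1"
      using x by (intro flat_exp2_affine_tendsto_0 filterlim_compose[OF flat_exp0_tendsto_1]
          filterlim_affine_at_top; simp)+
    have "(\<lambda>k. real n * cos (real n * x) * cutoff k x + sin (real n * x) *
        ((real (Suc k) * flat_exp 2 (real (Suc k) * x - 1)) * flat_exp 0 (real (Suc k) * (pi - x) - 1)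
        - flat_exp 0 (real (Suc k) * x - 1) * (real (Suc k) * flat_exp 2 (real (Suc k) * (pi - x) - 1))))
        \<longlonglongrightarrow> real n * cos (real n * x) * 1 + sin (real n * x) * (0 * 1 - 1 * 0)"
      by (intro tendsto_intros cutoff_tendsto_1 x lim)
    then show "(\<lambda>k. deriv (\<lambda>x. sin (real n * x) * cutoff k x) x) \<longlonglongrightarrow> real n * cos (real n * x)"
      unfolding deriv_sin_cutoff by (simp add: algebra_simps del: of_nat_Suc)
    fix k
    let ?s = "sin (real n * x)" and ?K = "real (Suc k)"
    let ?P = "\<bar>?s\<bar> * (?K * flat_exp 2 (?K * x - 1))" and ?Q = "\<bar>?s\<bar> * (?K * flat_exp 2 (?K * (pi - x) - 1))"
    have P: "0 \<le> ?P" "?P \<le> 3 * real n"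
      using flat_exp_nonneg abs_sin_mult_le[OF x, of n] by (auto intro!: flat_exp2_affine_bound simp del: of_nat_Suc)
    have Q: "0 \<le> ?Q" "?Q \<le> 3 * real n"
      using flat_exp_nonneg abs_sin_mult_le[OF x, of n] by (auto intro!: flat_exp2_affine_bound simp del: of_nat_Suc)
    have "\<bar>deriv (\<lambda>x. sin (real n * x) * cutoff k x) x\<bar> \<le> \<bar>real n * cos (real n * x) * cutoff k x\<bar> +
        (?P * flat_exp 0 (?K * (pi - x) - 1) + ?Q * flat_exp 0 (?K * x - 1))"
    proof -
      have "deriv (\<lambda>x. sin (real n * x) * cutoff k x) x = real n * cos (real n * x) * cutoff k x +
        (?s * (?K * flat_exp 2 (?K * x - 1)) * flat_exp 0 (?K * (pi - x) - 1)
          - ?s * (?K * flat_exp 2 (?K * (pi - x) - 1)) * flat_exp 0 (?K * x - 1))"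
        unfolding deriv_sin_cutoff by (simp add: algebra_simps del: of_nat_Suc)
      also have "\<bar>\<dots>\<bar> \<le> \<bar>real n * cos (real n * x) * cutoff k x\<bar> +
        (\<bar>?s * (?K * flat_exp 2 (?K * x - 1)) * flat_exp 0 (?K * (pi - x) - 1)\<bar>
          + \<bar>?s * (?K * flat_exp 2 (?K * (pi - x) - 1)) * flat_exp 0 (?K * x - 1)\<bar>)"
        by linarith
      finally show ?thesis
        using flat_exp_nonneg by (simp add: abs_mult del: of_nat_Suc)
    qed
    \<comment> \<open>The cosine term contributes n, each of the two slope terms 3 n; hence the
      dominating constant 7 n.\<close>
    also have "\<dots> \<le> real n * 1 * 1 + (3 * real n * 1 + 3 * real n * 1)"
    proof (rule add_mono, goal_cases)
      case 1
      show ?case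
        unfolding abs_mult using cutoff_bounds[of k x] by (intro mult_mono) auto
    next
      case 2
      show ?case
        by (intro add_mono mult_mono[OF P(2)] mult_mono[OF Q(2)] flat_exp0_bounds) auto
    qed
    finally show "\<bar>deriv (\<lambda>x. sin (real n * x) * cutoff k x) x\<bar> \<le> 7 * real n"
      by simp
  qed
  then show ?thesis
    by (simp add: cosine_def lsq_of_scale sq_int_continuous continuous_intros)
qed

section \<open>Sine coefficients of the Laplacian\<close>

lemma test_fun_has_derivative:
  "test_fun \<theta> \<Longrightarrow> (\<theta> has_real_derivative deriv \<theta> x) (at x)"
  unfolding test_fun_def by (metis funpow_0 DERIV_deriv_iff_real_differentiable)

lemma test_fun_continuous_on: "test_fun \<theta> \<Longrightarrow> continuous_on A \<theta>"
  using test_fun_has_derivative DERIV_continuous_on by (metis has_field_derivative_at_within)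

lemma test_fun_deriv_continuous_on:
  assumes "test_fun \<theta>"
  shows "continuous_on A (deriv \<theta>)"
proof -
  have "deriv \<theta> differentiable (at x)" for x
    using assms unfolding test_fun_def
    by (metis One_nat_def funpow_0 funpow_simps_right(2) comp_apply funpow_swap1)
  then show ?thesis
    by (meson continuous_at_imp_continuous_on differentiable_imp_continuous_within)
qed

lemma test_fun_eq_0: "test_fun \<theta> \<Longrightarrow> x \<notin> {0<..<pi} \<Longrightarrow> \<theta> x = 0"
  using closure_subset[of "{x. \<theta> x \<noteq> 0}"] unfolding test_fun_def by blast

text \<open>Integration by parts. The boundary terms vanish because \<theta> does, so the cosine may
  stand without a cut-off.\<close>

lemma inner_deriv_cosine:
  assumes "test_fun \<theta>"
  shows "inner (lsq_of (deriv \<theta>)) (cosine n) = real n * inner (lsq_of \<theta>) (sine n)"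
proof -
  have "((\<lambda>x. \<theta> x * cos (real n * x)) has_vector_derivative
      deriv \<theta> x * cos (real n * x) - \<theta> x * (real n * sin (real n * x))) (at x within {0..pi})" for x
    unfolding has_real_derivative_iff_has_vector_derivative[symmetric]
    by (rule DERIV_cong[OF DERIV_mult[OF has_field_derivative_at_within[OF
            test_fun_has_derivative[OF assms]]]])
      (auto intro!: derivative_eq_intros)
  then have "((\<lambda>x. deriv \<theta> x * cos (real n * x) - \<theta> x * (real n * sin (real n * x)))
      has_integral (\<theta> pi * cos (real n * pi) - \<theta> 0 * cos (real n * 0))) {0..pi}"
    by (intro fundamental_theorem_of_calculus) auto
  then have "integral {0..pi} (\<lambda>x. deriv \<theta> x * cos (real n * x) - \<theta> x * (real n * sin (real n * x))) = 0"
    using test_fun_eq_0[OF assms] by (simp add: integral_unique)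
  moreover have "integral {0..pi} (\<lambda>x. deriv \<theta> x * cos (real n * x) - \<theta> x * (real n * sin (real n * x)))
      = integral {0..pi} (\<lambda>x. deriv \<theta> x * cos (real n * x)) - integral {0..pi} (\<lambda>x. real n * (\<theta> x * sin (real n * x)))"
    using test_fun_continuous_on[OF assms] test_fun_deriv_continuous_on[OF assms]
    by (subst Henstock_Kurzweil_Integration.integral_diff[symmetric])
      (auto intro!: integrable_continuous_interval continuous_intros simp: algebra_simps)
  ultimately show ?thesis
    unfolding cosine_def sine_def
    using test_fun_continuous_on[OF assms] test_fun_deriv_continuous_on[OF assms]
    by (simp add: inner_lsq_of_continuous continuous_intros)
qed

text \<open>Test with the cut-off sines and let k tend to infinity; both sides converge because the
  functions and their derivatives do. No boundary value of g enters, as the sine vanishes at the end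
  points.\<close>

lemma weak_deriv_inner_sine:
  assumes "weak_deriv g h"
  shows "inner h (sine n) = - real n * inner g (cosine n)"
proof -
  have "(\<lambda>k. inner g (lsq_of (deriv (\<lambda>x. sin (real n * x) * cutoff k x))))
      \<longlonglongrightarrow> inner g (real n *\<^sub>R cosine n)"
    by (intro tendsto_inner tendsto_const deriv_sin_cutoff_tendsto)
  moreover have "inner g (lsq_of (deriv (\<lambda>x. sin (real n * x) * cutoff k x))) =
      - inner h (lsq_of (\<lambda>x. sin (real n * x) * cutoff k x))" for k
    using assms test_fun_cutoff[OF elem_smooth_sin_mult] unfolding weak_deriv_def by blast
  moreover have "(\<lambda>k. - inner h (lsq_of (\<lambda>x. sin (real n * x) * cutoff k x)))
      \<longlonglongrightarrow> - inner h (sine n)"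
    unfolding sine_def
    by (intro tendsto_minus tendsto_inner tendsto_const elem_smooth_cutoff_tendsto elem_smooth_sin_mult) simp
  ultimately have "inner g (real n *\<^sub>R cosine n) = - inner h (sine n)"
    using LIMSEQ_unique by simp
  then show ?thesis by simp
qed

text \<open>\<open>H10\<close> comes with its own weak derivative, which has to be compared with the
  one from \<open>H2\<close>. Only the cut-off cosines themselves must converge here, not their
  derivatives, so it does no harm that the cosine is nonzero at the end points.\<close>

lemma weak_deriv_inner_cosine_unique:
  assumes "weak_deriv w g" "weak_deriv w g'"
  shows "inner g (cosine n) = inner g' (cosine n)"
proof -
  have lim: "(\<lambda>k. inner h (lsq_of (\<lambda>x. cos (real n * x) * cutoff k x))) \<longlonglongrightarrow> inner h (cosine n)" for h
    unfolding cosine_def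
    by (intro tendsto_inner tendsto_const elem_smooth_cutoff_tendsto elem_smooth_cos_mult) simp
  have "inner g (lsq_of \<theta>) = inner g' (lsq_of \<theta>)" if "test_fun \<theta>" for \<theta>
    using assms that unfolding weak_deriv_def by force
  then have "(\<lambda>k. inner g (lsq_of (\<lambda>x. cos (real n * x) * cutoff k x))) =
      (\<lambda>k. inner g' (lsq_of (\<lambda>x. cos (real n * x) * cutoff k x)))"
    using test_fun_cutoff[OF elem_smooth_cos_mult] by blast
  with lim[of g] lim[of g'] show ?thesis
    by (metis LIMSEQ_unique)
qed

text \<open>The boundary condition enters here: the identity holds for test functions by parts and
  passes to the limit in the \<open>H10\<close> approximation.\<close>

lemma weak_deriv_inner_cosine:
  assumes "weak_deriv w g" and "w \<in> H10"
  shows "inner g (cosine n) = real n * inner w (sine n)"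
proof -
  obtain g' \<theta> where g': "weak_deriv w g'" and \<theta>: "\<And>k. test_fun (\<theta> k)"
    "(\<lambda>k. lsq_of (\<theta> k)) \<longlonglongrightarrow> w" "(\<lambda>k. lsq_of (deriv (\<theta> k))) \<longlonglongrightarrow> g'"
    using assms(2) unfolding H10_def by blast
  have "(\<lambda>k. inner (lsq_of (deriv (\<theta> k))) (cosine n)) \<longlonglongrightarrow> inner g' (cosine n)"
    by (intro tendsto_inner tendsto_const \<theta>)
  moreover have "(\<lambda>k. real n * inner (lsq_of (\<theta> k)) (sine n)) \<longlonglongrightarrow> real n * inner w (sine n)"
    by (intro tendsto_mult tendsto_inner tendsto_const \<theta>)
  ultimately have "inner g' (cosine n) = real n * inner w (sine n)"
    unfolding inner_deriv_cosine[OF \<theta>(1)] by (rule LIMSEQ_unique)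
  then show ?thesis
    using weak_deriv_inner_cosine_unique[OF assms(1) g'] by simp
qed

lemma sine_coeff_laplacian:
  assumes "w \<in> domA"
  shows "sine_coeff n (laplacian w) = - (real n)\<^sup>2 * sine_coeff n w"
proof -
  have "\<exists>h g. weak_deriv w g \<and> weak_deriv g h"
    using assms unfolding domA_def H2_def by blast
  \<comment> \<open>The choice operator yields some intermediate g; any will do, as the pairing with
    the cosine is the same for every weak derivative of w.\<close>
  then have "\<exists>g. weak_deriv w g \<and> weak_deriv g (laplacian w)"
    unfolding laplacian_def by (rule someI_ex)
  then obtain g where g: "weak_deriv w g" "weak_deriv g (laplacian w)"
    by blast
  have "inner g (cosine n) = real n * inner w (sine n)"
    using g(1) assms by (intro weak_deriv_inner_cosine) (auto simp: domA_def)
  then show ?thesis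
    unfolding sine_coeff_def weak_deriv_inner_sine[OF g(2)] by (simp add: power2_eq_square)
qed

section \<open>Completeness of the sines\<close>

inductive_set sine_poly :: "(real \<Rightarrow> real) set" where
  single: "(\<lambda>x. c * sin (real n * x)) \<in> sine_poly"
| add: "f \<in> sine_poly \<Longrightarrow> g \<in> sine_poly \<Longrightarrow> (\<lambda>x. f x + g x) \<in> sine_poly"

lemma sine_poly_continuous_on: "f \<in> sine_poly \<Longrightarrow> continuous_on A f"
  by (induction rule: sine_poly.induct) (auto intro!: continuous_intros)

lemma sine_poly_scale: "f \<in> sine_poly \<Longrightarrow> (\<lambda>x. c * f x) \<in> sine_poly"
proof (induction rule: sine_poly.induct)
  case (single d n)
  then show ?case
    using sine_poly.single[of "c * d" n] by (simp add: mult.assoc)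
next
  case (add f g)
  then show ?case
    using sine_poly.add by (simp add: distrib_left)
qed

text \<open>By product-to-sum, cos x sin(n x) is the mean of sin((n + 1) x) and sin((n - 1) x). This
  makes \<open>cos\<close> a multiplier of the class.\<close>

lemma sine_poly_mult_cos: "f \<in> sine_poly \<Longrightarrow> (\<lambda>x. cos x * f x) \<in> sine_poly"
proof (induction rule: sine_poly.induct)
  case (single c n)
  show ?case
  proof (cases n)
    case 0
    then show ?thesis using sine_poly.single[of 0 0] by simp
  next
    case (Suc m)
    have "cos x * (c * sin (real n * x)) =
        c / 2 * sin (real (Suc n) * x) + c / 2 * sin (real m * x)" for x
    proof -
      have "real (Suc n) * x = real n * x + x" "real m * x = real n * x - x"
        using Suc by (simp_all add: algebra_simps)
      then show ?thesis by (simp only: sin_add sin_diff) (simp add: algebra_simps)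
    qed
    then show ?thesis
      using sine_poly.add[OF sine_poly.single[of "c / 2" "Suc n"] sine_poly.single[of "c / 2" m]]
      by simp
  qed
next
  case (add f g)
  then show ?case
    using sine_poly.add by (simp add: distrib_left)
qed

lemma inner_sine_poly_eq_0:
  assumes "\<And>n. inner d (sine n) = 0" and "f \<in> sine_poly"
  shows "inner d (lsq_of f) = 0"
  using assms(2)
proof induction
  case (single c n)
  then show ?case
    using assms(1)[of n]
    by (simp add: lsq_of_scale sq_int_continuous continuous_intros sine_def)
next
  case (add f g)
  then show ?case
    by (simp add: lsq_of_add sq_int_continuous sine_poly_continuous_on inner_add_right)
qed

text \<open>The support of \<theta> keeps a distance from the end points, so near them the quotient
  is identically 0, also at the zeros of the sine, where division by zero gives 0.\<close>

lemma test_fun_div_sin_continuous_on: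
  assumes "test_fun \<theta>"
  shows "continuous_on {0..pi} (\<lambda>x. \<theta> x / sin x)"
proof (rule continuous_at_imp_continuous_on, intro ballI)
  fix x :: real assume x: "x \<in> {0..pi}"
  show "isCont (\<lambda>x. \<theta> x / sin x) x"
  proof (cases "x \<in> {0<..<pi}")
    case True
    then have "sin x \<noteq> 0" using sin_gt_zero[of x] by simp
    moreover have "isCont \<theta> x"
      using DERIV_isCont test_fun_has_derivative[OF assms] by blast
    ultimately show ?thesis by (intro continuous_intros) auto
  next
    case False
    let ?U = "- closure {x. \<theta> x \<noteq> 0}"
    have U: "open ?U" "x \<in> ?U"
      using False assms unfolding test_fun_def by auto
    have "\<theta> y / sin y = 0" if "y \<in> ?U" for y
      using that closure_subset[of "{x. \<theta> x \<noteq> 0}"] by auto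
    then have "continuous_on ?U (\<lambda>x. \<theta> x / sin x)"
      by (subst continuous_on_cong[OF refl, where g = "\<lambda>x. 0"]) auto
    then show ?thesis
      using U by (simp add: continuous_on_eq_continuous_at)
  qed
qed

text \<open>\<open>\<theta> x / sin x\<close> is approximated in the algebra generated by \<open>cos\<close>, which maps
  sine polynomials to sine polynomials.\<close>

lemma test_fun_sine_poly_approx:
  assumes "test_fun \<theta>" and "0 < e"
  shows "\<exists>h\<in>sine_poly. \<forall>x\<in>{0..pi}. \<bar>\<theta> x - h x\<bar> < e"
proof -
  \<comment> \<open>The algebra for Stone-Weierstrass consists of all continuous multipliers of
    \<open>sine_poly\<close>; its member \<open>cos\<close> separates points, being injective on
    [0, pi].\<close>
  define R where "R g \<longleftrightarrow> continuous_on {0..pi} g \<and>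
    (\<forall>h\<in>sine_poly. (\<lambda>x. g x * h x) \<in> sine_poly)" for g :: "real \<Rightarrow> real"
  have "\<exists>g. R g \<and> (\<forall>x\<in>{0..pi}. \<bar>\<theta> x / sin x - g x\<bar> < e)"
  proof (rule Stone_Weierstrass_HOL)
    show "R (\<lambda>x. c)" for c
      by (auto simp: R_def intro: sine_poly_scale)
    show "continuous_on {0..pi} g" if "R g" for g
      using that by (simp add: R_def)
    show "R (\<lambda>x. g x + h x)" if "R g \<and> R h" for g h
      using that sine_poly.add by (auto simp: R_def distrib_right intro: continuous_intros)
    show "R (\<lambda>x. g x * h x)" if "R g \<and> R h" for g h
      using that by (auto simp: R_def mult.assoc intro: continuous_intros)
    have "R cos"
      by (auto simp: R_def intro: sine_poly_mult_cos continuous_intros)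
    then show "\<exists>g. R g \<and> g x \<noteq> g y" if "x \<in> {0..pi} \<and> y \<in> {0..pi} \<and> x \<noteq> y" for x y
      using that cos_inj_pi[of x y] by auto
    show "continuous_on {0..pi} (\<lambda>x. \<theta> x / sin x)"
      by (rule test_fun_div_sin_continuous_on[OF assms(1)])
  qed (use assms in auto)
  then obtain g where g: "R g" "\<And>x. x \<in> {0..pi} \<Longrightarrow> \<bar>\<theta> x / sin x - g x\<bar> < e"
    by blast
  have "\<bar>\<theta> x - g x * sin x\<bar> < e" if x: "x \<in> {0..pi}" for x
  proof (cases "sin x = 0")
    case True
    then have "x \<notin> {0<..<pi}" using sin_gt_zero[of x] by auto
    then show ?thesis
      using True test_fun_eq_0[OF assms(1)] \<open>0 < e\<close> by simp
  next
    case False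
    then have "\<bar>\<theta> x - g x * sin x\<bar> = \<bar>\<theta> x / sin x - g x\<bar> * \<bar>sin x\<bar>"
      by (simp add: abs_mult[symmetric] algebra_simps)
    also have "\<dots> \<le> \<bar>\<theta> x / sin x - g x\<bar> * 1"
      by (intro mult_left_mono) auto
    finally show ?thesis using g(2)[OF x] by simp
  qed
  moreover have "(\<lambda>x. g x * sin x) \<in> sine_poly"
    using g(1) sine_poly.single[of 1 1] by (simp add: R_def)
  ultimately show ?thesis
    by (intro bexI[of _ "\<lambda>x. g x * sin x"] ballI)
qed

lemma inner_test_fun_eq_0:
  assumes "\<And>n. inner d (sine n) = 0" and "test_fun \<theta>"
  shows "inner d (lsq_of \<theta>) = 0"
proof (rule ccontr)
  assume neq: "inner d (lsq_of \<theta>) \<noteq> 0"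
  \<comment> \<open>Chosen so that Cauchy-Schwarz bounds the inner product by half of its own
    absolute value; \<open>norm d + 1\<close> keeps the denominator positive when d = 0.\<close>
  define e where "e = \<bar>inner d (lsq_of \<theta>)\<bar> / (2 * (norm d + 1) * sqrt pi)"
  have "0 < norm d + 1"
    using norm_ge_zero[of d] by linarith
  then have "0 < e"
    using neq by (simp add: e_def)
  from test_fun_sine_poly_approx[OF assms(2) this] obtain h where
    h: "h \<in> sine_poly" "\<And>x. x \<in> {0..pi} \<Longrightarrow> \<bar>\<theta> x - h x\<bar> < e" by blast
  note cont = test_fun_continuous_on[OF assms(2)] sine_poly_continuous_on[OF h(1)]
  have "norm (lsq_of (\<lambda>x. \<theta> x - h x)) \<le> sqrt pi * e"
    using h(2) \<open>0 < e\<close> by (intro norm_lsq_of_le continuous_intros cont) (auto intro: less_imp_le)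
  then have "norm d * norm (lsq_of (\<lambda>x. \<theta> x - h x)) \<le> (norm d + 1) * (sqrt pi * e)"
    by (intro mult_mono) auto
  moreover have "inner d (lsq_of \<theta>) = inner d (lsq_of (\<lambda>x. \<theta> x - h x))"
    using inner_sine_poly_eq_0[OF assms(1) h(1)]
    by (simp add: lsq_of_diff sq_int_continuous cont inner_diff_right)
  ultimately have "\<bar>inner d (lsq_of \<theta>)\<bar> \<le> (norm d + 1) * (sqrt pi * e)"
    using Cauchy_Schwarz_ineq2 order_trans by metis
  also have "\<dots> = \<bar>inner d (lsq_of \<theta>)\<bar> / 2"
    using \<open>0 < norm d + 1\<close> by (simp add: e_def divide_simps)
  finally show False using neq by simp
qed

text \<open>Density of the sines in the form used later: d is arbitrary in L^2, because it will be w
  - S with S known only as the sum of a series.\<close>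

lemma inner_H10_eq_0:
  assumes "\<And>n. inner d (sine n) = 0" and "w \<in> H10"
  shows "inner d w = 0"
proof -
  obtain \<theta> where \<theta>: "\<And>k. test_fun (\<theta> k)" "(\<lambda>k. lsq_of (\<theta> k)) \<longlonglongrightarrow> w"
    using assms(2) unfolding H10_def by blast
  have "(\<lambda>k. inner d (lsq_of (\<theta> k))) \<longlonglongrightarrow> inner d w"
    by (intro tendsto_inner tendsto_const \<theta>)
  then show ?thesis
    using inner_test_fun_eq_0[OF assms(1) \<theta>(1)] by (simp add: LIMSEQ_const_iff)
qed

section \<open>Sine series\<close>

lemma integral_cos_int:
  assumes "k \<noteq> (0::int)"
  shows "integral {0..pi} (\<lambda>x. cos (of_int k * x)) = 0"
proof -
  have "((\<lambda>x. sin (of_int k * x) / of_int k) has_vector_derivative cos (of_int k * x)) (at x within {0..pi})"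
    for x :: real
    unfolding has_real_derivative_iff_has_vector_derivative[symmetric]
    using assms by (auto intro!: derivative_eq_intros)
  then have "((\<lambda>x. cos (of_int k * x)) has_integral
      (sin (of_int k * pi) / of_int k - sin (of_int k * 0) / of_int k)) {0..pi}"
    by (intro fundamental_theorem_of_calculus) auto
  then show ?thesis
    using sin_zero_iff_int2[of "of_int k * pi"] by (auto simp: integral_unique)
qed

text \<open>Product-to-sum formula; the assumption on n makes the frequency m + n nonzero, so only m
  - n can contribute.\<close>

lemma inner_sine:
  assumes "0 < n"
  shows "inner (sine m) (sine n) = (if m = n then pi / 2 else 0)"
proof -
  have "inner (sine m) (sine n) = integral {0..pi} (\<lambda>x. sin (real m * x) * sin (real n * x))"
    unfolding sine_def by (intro inner_lsq_of_continuous continuous_intros)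
  also have "\<dots> = integral {0..pi}
      (\<lambda>x. (1 / 2) * (cos (of_int (int m - int n) * x) - cos (of_int (int m + int n) * x)))"
    by (rule Henstock_Kurzweil_Integration.integral_cong)
      (simp add: cos_add cos_diff algebra_simps)
  also have "\<dots> = (1 / 2) * (integral {0..pi} (\<lambda>x. cos (of_int (int m - int n) * x))
      - integral {0..pi} (\<lambda>x. cos (of_int (int m + int n) * x)))"
    by (subst Henstock_Kurzweil_Integration.integral_diff[symmetric])
      (auto intro!: integrable_continuous_interval continuous_intros simp del: of_int_diff of_int_add)
  also have "integral {0..pi} (\<lambda>x. cos (of_int (int m + int n) * x)) = 0"
    using assms by (intro integral_cos_int) auto
  also have "integral {0..pi} (\<lambda>x. cos (of_int (int m - int n) * x)) = (if m = n then pi else 0)"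
    using integral_cos_int[of "int m - int n"] by auto
  finally show ?thesis by (simp split: if_splits)
qed

lemma sine_0: "sine 0 = 0"
  unfolding sine_def by transfer (simp add: ae_eq_def sq_int_zero)

lemma norm_sine_le: "norm (sine n) \<le> sqrt pi"
  using norm_lsq_of_le[of "\<lambda>x. sin (real n * x)" 1] by (simp add: sine_def continuous_intros)

lemma norm_sine_sum:
  "(norm (\<Sum>k<N. c k *\<^sub>R sine (Suc k)))\<^sup>2 = pi / 2 * (\<Sum>k<N. (c k)\<^sup>2)"
proof -
  have "(norm (\<Sum>k<N. c k *\<^sub>R sine (Suc k)))\<^sup>2 =
      (\<Sum>k<N. \<Sum>l<N. c k * (c l * (if l = k then pi / 2 else 0)))"
    by (simp add: power2_norm_eq_inner inner_sum_left inner_sum_right inner_sine sum_distrib_left)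
  also have "\<dots> = (\<Sum>k<N. pi / 2 * (c k)\<^sup>2)"
    by (rule sum.cong) (auto simp: if_distrib[of "\<lambda>x. _ * x"] power2_eq_square cong: if_cong)
  finally show ?thesis by (simp add: sum_distrib_left)
qed

text \<open>Expand the squared norm of w - S, where S is the partial sum: its inner products with w
  and with itself both equal the left-hand side.\<close>

lemma bessel:
  "pi / 2 * (\<Sum>k<N. (sine_coeff (Suc k) w)\<^sup>2) \<le> (norm w)\<^sup>2"
proof -
  define S where "S = (\<Sum>k<N. sine_coeff (Suc k) w *\<^sub>R sine (Suc k))"
  have "inner w S = pi / 2 * (\<Sum>k<N. (sine_coeff (Suc k) w)\<^sup>2)"
    unfolding S_def inner_sum_right sum_distrib_left
    by (rule sum.cong) (auto simp: sine_coeff_def power2_eq_square)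
  moreover have "inner S S = pi / 2 * (\<Sum>k<N. (sine_coeff (Suc k) w)\<^sup>2)"
    unfolding S_def power2_norm_eq_inner[symmetric] by (rule norm_sine_sum)
  moreover have "0 \<le> inner (w - S) (w - S)" by simp
  ultimately show ?thesis
    by (simp add: inner_diff_left inner_diff_right inner_commute power2_norm_eq_inner)
qed

text \<open>Completeness of \<open>L\<^sup>2\<close> is not needed: absolute summability of the coefficients gives
  uniform convergence.\<close>

lemma summable_sine_series:
  assumes "summable (\<lambda>k. \<bar>c k\<bar>)"
  shows "summable (\<lambda>k. c k *\<^sub>R sine (Suc k))"
proof -
  define g where "g x = (\<Sum>k. c k * sin (real (Suc k) * x))" for x
  have lim: "uniform_limit UNIV (\<lambda>N x. \<Sum>k<N. c k * sin (real (Suc k) * x)) g sequentially"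
    unfolding g_def using assms
    by (intro Weierstrass_m_test[where M = "\<lambda>k. \<bar>c k\<bar>"]) (auto simp: abs_mult intro: mult_left_le)
  have g: "continuous_on UNIV g"
    by (rule uniform_limit_theorem[OF _ lim]) (auto intro!: always_eventually continuous_intros)
  have part: "lsq_of (\<lambda>x. \<Sum>k<N. c k * sin (real (Suc k) * x)) = (\<Sum>k<N. c k *\<^sub>R sine (Suc k))" for N
  proof (induction N)
    case 0
    show ?case using sine_0 by (simp add: sine_def)
  next
    case (Suc N)
    then show ?case
      by (simp add: lsq_of_add lsq_of_scale sq_int_continuous continuous_intros sine_def
          del: of_nat_Suc)
  qed
  have "(\<lambda>N. \<Sum>k<N. c k *\<^sub>R sine (Suc k)) \<longlonglongrightarrow> lsq_of g"
  proof (rule metric_LIMSEQ_I)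
    fix r :: real assume "0 < r"
    define e where "e = r / (2 * sqrt pi)"
    have "0 < e" using \<open>0 < r\<close> by (simp add: e_def)
    from uniform_limitD[OF lim this] obtain N0 where
      N0: "\<And>N x. N \<ge> N0 \<Longrightarrow> \<bar>(\<Sum>k<N. c k * sin (real (Suc k) * x)) - g x\<bar> < e"
      unfolding eventually_sequentially dist_real_def by blast
    show "\<exists>no. \<forall>N\<ge>no. dist (\<Sum>k<N. c k *\<^sub>R sine (Suc k)) (lsq_of g) < r"
    proof (intro exI[of _ N0] allI impI)
      fix N assume "N \<ge> N0"
      note cont = continuous_on_subset[OF g subset_UNIV]
      have "dist (\<Sum>k<N. c k *\<^sub>R sine (Suc k)) (lsq_of g) =
          norm (lsq_of (\<lambda>x. (\<Sum>k<N. c k * sin (real (Suc k) * x)) - g x))"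
        unfolding dist_norm part[symmetric]
        by (subst lsq_of_diff) (auto intro!: sq_int_continuous continuous_intros cont)
      also have "\<dots> \<le> sqrt pi * e"
        using N0[OF \<open>N \<ge> N0\<close>] \<open>0 < e\<close>
        by (intro norm_lsq_of_le continuous_intros cont) (auto intro: less_imp_le)
      also have "\<dots> < r"
        using \<open>0 < r\<close> by (simp add: e_def)
      finally show "dist (\<Sum>k<N. c k *\<^sub>R sine (Suc k)) (lsq_of g) < r" .
    qed
  qed
  then show ?thesis
    by (auto simp: summable_def sums_def)
qed

text \<open>The coefficients of the Laplacian are bounded by Cauchy-Schwarz and equal -n^2 times
  those of w, which leaves decay of order 1/n^2.\<close>

lemma summable_sine_coeff:
  assumes "w \<in> domA"
  shows "summable (\<lambda>k. \<bar>sine_coeff (Suc k) w\<bar>)"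
proof (rule summable_comparison_test')
  define B where "B = 2 / pi * (norm (laplacian w) * sqrt pi)"
  have "summable (\<lambda>k. inverse (real (Suc k) ^ 2))"
    using inverse_power_summable[of 2, where 'a = real] by (subst summable_Suc_iff) simp
  then show "summable (\<lambda>k. B * inverse ((real (Suc k))\<^sup>2))"
    by (rule summable_mult)
  fix k :: nat
  have "\<bar>sine_coeff (Suc k) (laplacian w)\<bar> \<le> B"
    unfolding sine_coeff_def B_def abs_mult
    using order_trans[OF Cauchy_Schwarz_ineq2 mult_left_mono[OF norm_sine_le norm_ge_zero]]
    by (intro mult_mono) auto
  then have "(real (Suc k))\<^sup>2 * \<bar>sine_coeff (Suc k) w\<bar> \<le> B"
    by (simp add: sine_coeff_laplacian[OF assms] abs_mult del: of_nat_Suc)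
  then show "norm \<bar>sine_coeff (Suc k) w\<bar> \<le> B * inverse ((real (Suc k))\<^sup>2)"
    by (simp add: field_simps del: of_nat_Suc)
qed

text \<open>The remainder w - S is orthogonal to every sine, hence to S, a limit of sine sums, and
  to w, a member of \<open>H10\<close>; so it is orthogonal to itself.\<close>

lemma sine_series_sums:
  assumes "w \<in> domA"
  shows "(\<lambda>k. sine_coeff (Suc k) w *\<^sub>R sine (Suc k)) sums w"
proof -
  define S where "S = (\<Sum>k. sine_coeff (Suc k) w *\<^sub>R sine (Suc k))"
  have S: "(\<lambda>k. sine_coeff (Suc k) w *\<^sub>R sine (Suc k)) sums S"
    unfolding S_def by (intro summable_sums summable_sine_series summable_sine_coeff assms)
  have orth: "inner (w - S) (sine n) = 0" for n
  proof (cases n)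
    case (Suc m)
    have "(\<lambda>k. inner (sine_coeff (Suc k) w *\<^sub>R sine (Suc k)) (sine n)) sums inner S (sine n)"
      by (rule bounded_linear.sums[OF bounded_linear_inner_left S])
    moreover have "(\<lambda>k. inner (sine_coeff (Suc k) w *\<^sub>R sine (Suc k)) (sine n)) =
        (\<lambda>k. if k = m then sine_coeff (Suc m) w * (pi / 2) else 0)"
      using Suc by (auto simp: inner_sine)
    ultimately have "inner S (sine n) = sine_coeff (Suc m) w * (pi / 2)"
      using sums_unique2 sums_single[of m "\<lambda>_. sine_coeff (Suc m) w * (pi / 2)"] by fastforce
    then show ?thesis
      using Suc by (simp add: inner_diff_left sine_coeff_def)
  qed (simp add: sine_0)
  have "inner (w - S) w = 0"
    using assms by (intro inner_H10_eq_0[OF orth]) (simp add: domA_def)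
  moreover have "inner (w - S) S = 0"
  proof -
    have "(\<lambda>k. inner (w - S) (sine_coeff (Suc k) w *\<^sub>R sine (Suc k))) sums inner (w - S) S"
      by (rule bounded_linear.sums[OF bounded_linear_inner_right S])
    then show ?thesis
      using orth sums_unique2[OF sums_zero] by fastforce
  qed
  ultimately have "inner (w - S) (w - S) = 0"
    by (simp add: inner_diff_right)
  then show ?thesis using S by simp
qed

section \<open>The characteristics\<close>

lemma bounded_linear_sine_coeff: "bounded_linear (sine_coeff n)"
  unfolding sine_coeff_def[abs_def]
  by (intro bounded_linear_const_mult bounded_linear_inner_left)

text \<open>The C^1 class supplies a total derivative, whose values at (1, 0) and (0, 1) are the
  partial derivatives in the equation. Since \<eta> runs backwards, the chain rule evaluates it at
  (-1, -1), which explains the minus sign.\<close>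

lemma has_vector_derivative_characteristic:
  assumes sol: "solution T f \<phi> \<psi> u" and "0 < T" and S: "S \<subseteq> {\<eta>. (a - \<eta>, b - \<eta>) \<in> {0..T} \<times> {0..T}}"
    and "\<eta> \<in> S"
  shows "((\<lambda>\<eta>. u (a - \<eta>, b - \<eta>)) has_vector_derivative
    - (f (a - \<eta>, b - \<eta>) + laplacian (u (a - \<eta>, b - \<eta>)))) (at \<eta> within S)"
proof -
  let ?Q = "{0..T} \<times> {0..T}"
  obtain u' where u': "\<And>z. z \<in> ?Q \<Longrightarrow> (u has_derivative blinfun_apply (u' z)) (at z within ?Q)"
    using sol unfolding solution_def C1_lsq_def by blast
  define t s where "t = a - \<eta>" and "s = b - \<eta>"
  have ts: "t \<in> {0..T}" "s \<in> {0..T}"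
    using S \<open>\<eta> \<in> S\<close> by (auto simp: t_def s_def)
  note du = u'[of "(t, s)"]
  have "((\<lambda>\<tau>. u (\<tau>, s)) has_derivative (\<lambda>h. u' (t, s) (h, 0))) (at t within {0..T})"
  proof -
    have "((\<lambda>\<tau>. (\<tau>, s)) has_derivative (\<lambda>h. (h, 0))) (at t within {0..T})"
      by (auto intro!: derivative_eq_intros)
    moreover have "(u has_derivative u' (t, s)) (at (t, s) within (\<lambda>\<tau>. (\<tau>, s)) ` {0..T})"
      using du ts by (auto intro: has_derivative_subset)
    ultimately show ?thesis
      using diff_chain_within by (fastforce simp: o_def)
  qed
  then have "((\<lambda>\<tau>. u (\<tau>, s)) has_vector_derivative u' (t, s) (1, 0)) (at t within {0..T})"
    unfolding has_vector_derivative_def by (simp flip: blinfun.scaleR_right)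
  \<comment> \<open>As T > 0, the interval is nondegenerate, so the derivative within it is unique
    and \<open>vector_derivative\<close> denotes it.\<close>
  then have 1: "vector_derivative (\<lambda>\<tau>. u (\<tau>, s)) (at t within {0..T}) = u' (t, s) (1, 0)"
    using vector_derivative_within_cbox[of 0 T t] ts \<open>0 < T\<close> by simp
  have "((\<lambda>\<sigma>. u (t, \<sigma>)) has_derivative (\<lambda>h. u' (t, s) (0, h))) (at s within {0..T})"
  proof -
    have "((\<lambda>\<sigma>. (t, \<sigma>)) has_derivative (\<lambda>h. (0, h))) (at s within {0..T})"
      by (auto intro!: derivative_eq_intros)
    moreover have "(u has_derivative u' (t, s)) (at (t, s) within (\<lambda>\<sigma>. (t, \<sigma>)) ` {0..T})"
      using du ts by (auto intro: has_derivative_subset)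
    ultimately show ?thesis
      using diff_chain_within by (fastforce simp: o_def)
  qed
  then have "((\<lambda>\<sigma>. u (t, \<sigma>)) has_vector_derivative u' (t, s) (0, 1)) (at s within {0..T})"
    unfolding has_vector_derivative_def by (simp flip: blinfun.scaleR_right)
  then have 2: "vector_derivative (\<lambda>\<sigma>. u (t, \<sigma>)) (at s within {0..T}) = u' (t, s) (0, 1)"
    using vector_derivative_within_cbox[of 0 T s] ts \<open>0 < T\<close> by simp
  have "u' (t, s) (1, 0) + u' (t, s) (0, 1) - laplacian (u (t, s)) = f (t, s)"
    using sol ts unfolding solution_def 1[symmetric] 2[symmetric] by blast
  moreover have "u' (t, s) (1, 1) = u' (t, s) (1, 0) + u' (t, s) (0, 1)"
    by (simp flip: blinfun.add_right)
  moreover have "u' (t, s) (-1, -1) = - u' (t, s) (1, 1)"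
    by (simp flip: blinfun.minus_right)
  ultimately have eq: "u' (t, s) (-1, -1) = - (f (t, s) + laplacian (u (t, s)))"
    by (simp add: algebra_simps)
  have "((\<lambda>\<eta>. (a - \<eta>, b - \<eta>)) has_derivative (\<lambda>h. (- h, - h))) (at \<eta> within S)"
    by (auto intro!: derivative_eq_intros)
  moreover have "(u has_derivative u' (t, s)) (at (t, s) within (\<lambda>\<eta>. (a - \<eta>, b - \<eta>)) ` S)"
    using ts S by (intro has_derivative_subset[OF du]) auto
  ultimately have "((\<lambda>\<eta>. u (a - \<eta>, b - \<eta>)) has_derivative (\<lambda>h. u' (t, s) (- h, - h))) (at \<eta> within S)"
    using diff_chain_within[of "\<lambda>\<eta>. (a - \<eta>, b - \<eta>)" _ \<eta> S u] by (simp add: o_def t_def s_def)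
  moreover have "(\<lambda>h. u' (t, s) (- h, - h)) = (\<lambda>h. h *\<^sub>R - (f (t, s) + laplacian (u (t, s))))"
  proof
    fix h
    have "u' (t, s) (- h, - h) = h *\<^sub>R u' (t, s) (-1, -1)"
      by (simp flip: blinfun.scaleR_right)
    then show "u' (t, s) (- h, - h) = h *\<^sub>R - (f (t, s) + laplacian (u (t, s)))"
      by (simp only: eq)
  qed
  ultimately show ?thesis
    unfolding has_vector_derivative_def by (simp only: t_def s_def)
qed

text \<open>The exponential is an integrating factor: in the derivative of \<open>G\<close> the two
  terms with n^2 cancel and only the source remains. At \<eta> = T the characteristic is at (t, s);
  with m = t or m = s it starts at \<eta> = m on the side of the square that carries the
  data.\<close>

lemma sine_coeff_duhamel:
  assumes sol: "solution T f \<phi> \<psi> u" and "0 < T" and "m \<le> T"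
    and S: "\<And>\<eta>. \<eta> \<in> {m..T} \<Longrightarrow> (T + t - \<eta>, T + s - \<eta>) \<in> {0..T} \<times> {0..T}"
  shows "integral {m..T} (\<lambda>\<eta>. exp ((m - \<eta>) * (real n)\<^sup>2) * sine_coeff n (f (T + t - \<eta>, T + s - \<eta>))) =
    sine_coeff n (u (T + t - m, T + s - m)) - exp ((m - T) * (real n)\<^sup>2) * sine_coeff n (u (t, s))"
proof -
  let ?N = "(real n)\<^sup>2" and ?z = "\<lambda>\<eta>. (T + t - \<eta>, T + s - \<eta>)"
  define G where "G \<eta> = exp ((m - \<eta>) * ?N) * sine_coeff n (u (?z \<eta>))" for \<eta>
  have "(G has_vector_derivative - (exp ((m - \<eta>) * ?N) * sine_coeff n (f (?z \<eta>)))) (at \<eta> within {m..T})"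
    if \<eta>: "\<eta> \<in> {m..T}" for \<eta>
  proof -
    have "((\<lambda>\<eta>. u (?z \<eta>)) has_vector_derivative - (f (?z \<eta>) + laplacian (u (?z \<eta>)))) (at \<eta> within {m..T})"
      using S \<eta> by (intro has_vector_derivative_characteristic[OF sol \<open>0 < T\<close>]) auto
    from bounded_linear.has_vector_derivative[OF bounded_linear_sine_coeff this]
    have "((\<lambda>\<eta>. sine_coeff n (u (?z \<eta>))) has_real_derivative
        sine_coeff n (- (f (?z \<eta>) + laplacian (u (?z \<eta>))))) (at \<eta> within {m..T})"
      by (simp add: has_real_derivative_iff_has_vector_derivative)
    also have "sine_coeff n (- (f (?z \<eta>) + laplacian (u (?z \<eta>)))) =
        ?N * sine_coeff n (u (?z \<eta>)) - sine_coeff n (f (?z \<eta>))"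
    proof -
      interpret linear "sine_coeff n"
        by (rule bounded_linear.linear[OF bounded_linear_sine_coeff])
      have "u (?z \<eta>) \<in> domA"
        using sol S[OF \<eta>] unfolding solution_def C0_domA_def by blast
      then show ?thesis
        by (simp add: neg add sine_coeff_laplacian del: minus_add_distrib)
    qed
    finally have du: "((\<lambda>\<eta>. sine_coeff n (u (?z \<eta>))) has_real_derivative
        ?N * sine_coeff n (u (?z \<eta>)) - sine_coeff n (f (?z \<eta>))) (at \<eta> within {m..T})" .
    have "((\<lambda>\<eta>. exp ((m - \<eta>) * ?N)) has_real_derivative - ?N * exp ((m - \<eta>) * ?N)) (at \<eta> within {m..T})"
      by (auto intro!: derivative_eq_intros)
    from DERIV_mult[OF this du] show ?thesis
      unfolding G_def[abs_def] has_real_derivative_iff_has_vector_derivative[symmetric]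
      by (rule DERIV_cong) (simp add: algebra_simps)
  qed
  then have "((\<lambda>\<eta>. - (exp ((m - \<eta>) * ?N) * sine_coeff n (f (?z \<eta>)))) has_integral (G T - G m)) {m..T}"
    using \<open>m \<le> T\<close> by (intro fundamental_theorem_of_calculus) auto
  from has_integral_neg[OF this]
  have "((\<lambda>\<eta>. exp ((m - \<eta>) * ?N) * sine_coeff n (f (?z \<eta>))) has_integral (G m - G T)) {m..T}"
    by simp
  then show ?thesis
    by (simp add: G_def integral_unique)
qed

section \<open>The error estimate\<close>

text \<open>Both bounds concern y = (1 + x) powr (-a), which lies between 1/(1 + x) and 1 because a
  is in [0, 1]. The first will give convergence of the bias series, the second its size.\<close>

lemma regularization_factor:
  fixes \<epsilon> a r :: real
  assumes "0 < \<epsilon>" and "0 \<le> a" "a \<le> 1"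
  shows "\<bar>(\<epsilon> + exp (- r)) powr (- a) * exp (- a * r) - 1\<bar> \<le> 1"
    and "\<bar>(\<epsilon> + exp (- r)) powr (- a) * exp (- a * r) - 1\<bar> \<le> \<epsilon> powr (1 - a) * exp ((1 - a) * r)"
proof -
  define x where "x = \<epsilon> * exp r"
  have x: "0 < x" using assms by (simp add: x_def)
  define y where "y = (1 + x) powr (- a)"
  have "\<epsilon> + exp (- r) = (1 + x) * exp (- r)"
    by (simp add: x_def distrib_right exp_minus)
  then have "(\<epsilon> + exp (- r)) powr (- a) = y * exp (a * r)"
    using x by (simp add: y_def powr_mult exp_powr_real mult.commute)
  then have eq: "(\<epsilon> + exp (- r)) powr (- a) * exp (- a * r) = y"
    by (simp add: mult.assoc exp_add[symmetric])
  have "y \<le> (1 + x) powr 0"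
    unfolding y_def using x assms by (intro powr_mono) auto
  then have y1: "y \<le> 1" using x by simp
  have "(1 + x) powr (- 1) \<le> y"
    unfolding y_def using x assms by (intro powr_mono) auto
  then have y2: "1 / (1 + x) \<le> y"
    using x by (simp add: powr_minus_divide)
  have "1 - y \<le> x / (1 + x)"
    using y2 x by (simp add: field_simps)
  also have "\<dots> \<le> x powr (1 - a)"
  \<comment> \<open>For x <= 1, the quotient is at most x, and lowering the exponent to 1 - a
    increases the power; for x > 1, it is at most 1, which is at most the power.\<close>
  proof (cases "x \<le> 1")
    case True
    have "x / (1 + x) \<le> x powr 1"
      using x by (simp add: field_simps)
    also have "\<dots> \<le> x powr (1 - a)"
      using x True assms by (intro powr_mono') auto
    finally show ?thesis .
  next
    case False
    have "x / (1 + x) \<le> 1 powr (1 - a)" using x by simp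
    also have "\<dots> \<le> x powr (1 - a)"
      using False assms by (intro powr_mono2) auto
    finally show ?thesis .
  qed
  also have "\<dots> = \<epsilon> powr (1 - a) * exp ((1 - a) * r)"
    using assms by (simp add: x_def powr_mult exp_powr_real mult.commute)
  finally have *: "1 - y \<le> \<epsilon> powr (1 - a) * exp ((1 - a) * r)" .
  have "0 \<le> y" by (simp add: y_def)
  with y1 show "\<bar>(\<epsilon> + exp (- r)) powr (- a) * exp (- a * r) - 1\<bar> \<le> 1"
    unfolding eq by linarith
  show "\<bar>(\<epsilon> + exp (- r)) powr (- a) * exp (- a * r) - 1\<bar> \<le> \<epsilon> powr (1 - a) * exp ((1 - a) * r)"
    unfolding eq using y1 * by linarith
qed

lemma norm_sine_series_le:
  assumes "(\<lambda>k. c k *\<^sub>R sine (Suc k)) sums S" and "0 \<le> B"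
    and "\<And>N. pi / 2 * (\<Sum>k<N. (c k)\<^sup>2) \<le> B\<^sup>2"
  shows "norm S \<le> B"
proof (rule LIMSEQ_le_const2)
  show "(\<lambda>N. norm (\<Sum>k<N. c k *\<^sub>R sine (Suc k))) \<longlonglongrightarrow> norm S"
    using assms(1) unfolding sums_def by (rule tendsto_norm)
  have "norm (\<Sum>k<N. c k *\<^sub>R sine (Suc k)) \<le> B" for N
    using assms(2) assms(3)[of N] unfolding norm_sine_sum[symmetric] by (rule power2_le_imp_le[rotated])
  then show "\<exists>N. \<forall>n\<ge>N. norm (\<Sum>k<n. c k *\<^sub>R sine (Suc k)) \<le> B" by blast
qed

text \<open>One estimate for both triangles: \<tau> is t or s, \<alpha> and \<beta> are the
  perturbed and the exact datum where the characteristic meets the boundary, and w is u(t,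
  s).\<close>

lemma regularized_series_estimate:
  fixes T p \<epsilon> \<tau> C :: real
  assumes "0 < p" and "0 < \<epsilon>" and "\<tau> \<le> T" "T - \<tau> \<le> p"
    and dom: "\<alpha> \<in> domA" "\<beta> \<in> domA" "w \<in> domA" and "norm (\<alpha> - \<beta>) \<le> \<epsilon>"
    and C: "\<And>N. pi / 2 * (\<Sum>k<N. exp (2 * (p + \<tau> - T) * (real (Suc k))\<^sup>2) *
      \<bar>sine_coeff (Suc k) w\<bar>\<^sup>2) \<le> C"
    and c: "\<And>k. c k = (\<epsilon> + exp (- p * (real (Suc k))\<^sup>2)) powr ((\<tau> - T) / p) *
      (sine_coeff (Suc k) \<alpha> - sine_coeff (Suc k) \<beta>
        + exp ((\<tau> - T) * (real (Suc k))\<^sup>2) * sine_coeff (Suc k) w)"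
  shows "summable (\<lambda>k. c k *\<^sub>R sine (Suc k))"
    and "norm ((\<Sum>k. c k *\<^sub>R sine (Suc k)) - w) \<le> (1 + sqrt C) * \<epsilon> powr ((\<tau> - T + p) / p)"
proof -
  define a where "a = (T - \<tau>) / p"
  have a: "0 \<le> a" "a \<le> 1" "(\<tau> - T) / p = - a" "(\<tau> - T + p) / p = 1 - a"
    using assms by (simp_all add: a_def field_simps)
  define M where "M = \<epsilon> powr (1 - a)"
  define A where "A k = (\<epsilon> + exp (- p * (real (Suc k))\<^sup>2)) powr (- a)" for k
  define d where "d k = A k * sine_coeff (Suc k) (\<alpha> - \<beta>)" for k
  define e where "e k = (A k * exp (- a * (p * (real (Suc k))\<^sup>2)) - 1) * sine_coeff (Suc k) w" for k
  have exponent: "- a * (p * n) = (\<tau> - T) * n" "(1 - a) * (p * n) = (p + \<tau> - T) * n" for n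
    using \<open>0 < p\<close> by (simp_all add: a_def field_simps)
  have diff: "sine_coeff n (\<alpha> - \<beta>) = sine_coeff n \<alpha> - sine_coeff n \<beta>" for n
    by (rule linear_diff[OF bounded_linear.linear[OF bounded_linear_sine_coeff]])
  have c_eq: "c k = d k + e k + sine_coeff (Suc k) w" for k
    unfolding c d_def e_def A_def diff a(3) exponent by (simp add: algebra_simps)
  have A: "0 \<le> A k" "A k \<le> \<epsilon> powr (- a)" for k
    unfolding A_def using assms a by (auto intro!: powr_mono2')
  have d_le: "\<bar>d k\<bar> \<le> \<epsilon> powr (- a) * \<bar>sine_coeff (Suc k) (\<alpha> - \<beta>)\<bar>" for k
    unfolding d_def abs_mult using A[of k] by (intro mult_right_mono) auto
  have e_le: "\<bar>e k\<bar> \<le> \<bar>sine_coeff (Suc k) w\<bar>"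
    "\<bar>e k\<bar> \<le> M * (exp ((p + \<tau> - T) * (real (Suc k))\<^sup>2) * \<bar>sine_coeff (Suc k) w\<bar>)" for k
    using mult_right_mono[OF regularization_factor(1)[OF \<open>0 < \<epsilon>\<close> a(1,2), of "p * (real (Suc k))\<^sup>2"]
        abs_ge_zero[of "sine_coeff (Suc k) w"]]
      mult_right_mono[OF regularization_factor(2)[OF \<open>0 < \<epsilon>\<close> a(1,2), of "p * (real (Suc k))\<^sup>2"]
        abs_ge_zero[of "sine_coeff (Suc k) w"]]
    unfolding e_def A_def M_def exponent abs_mult[symmetric] by (simp_all add: mult.assoc)
  have "summable (\<lambda>k. \<bar>sine_coeff (Suc k) (\<alpha> - \<beta>)\<bar>)"
    by (rule summable_comparison_test'[OF summable_add[OF dom(1,2)[THEN summable_sine_coeff]]])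
      (simp add: diff abs_triangle_ineq4)
  then have "summable (\<lambda>k. \<epsilon> powr (- a) * \<bar>sine_coeff (Suc k) (\<alpha> - \<beta>)\<bar>)"
    by (rule summable_mult)
  then have "summable (\<lambda>k. \<bar>d k\<bar>)"
    by (rule summable_comparison_test') (use d_le in auto)
  then obtain D where D: "(\<lambda>k. d k *\<^sub>R sine (Suc k)) sums D"
    using summable_sine_series unfolding summable_def by blast
  \<comment> \<open>The crude bound of the bias factor by 1 gives absolute summability; the weighted
    bound controls only sums of squares.\<close>
  have "summable (\<lambda>k. \<bar>e k\<bar>)"
    by (rule summable_comparison_test'[OF summable_sine_coeff[OF dom(3)]]) (use e_le in auto)
  then obtain E where E: "(\<lambda>k. e k *\<^sub>R sine (Suc k)) sums E"
    using summable_sine_series unfolding summable_def by blast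
  have sums: "(\<lambda>k. c k *\<^sub>R sine (Suc k)) sums (D + E + w)"
    using sums_add[OF sums_add[OF D E] sine_series_sums[OF dom(3)]]
    by (simp add: c_eq scaleR_add_left)
  show "summable (\<lambda>k. c k *\<^sub>R sine (Suc k))"
    using sums by (rule sums_summable)
  \<comment> \<open>A data error of size \<epsilon>, amplified by at most \<epsilon> powr (-a), has
    the size M of the final rate; this is the summand 1 in 1 + sqrt C.\<close>
  have M: "0 \<le> M" "\<epsilon> powr (- a) * \<epsilon> = M"
    using \<open>0 < \<epsilon>\<close> powr_add[of \<epsilon> "- a" 1] by (simp_all add: M_def)
  have "norm D \<le> M"
  proof (rule norm_sine_series_le[OF D M(1)])
    fix N
    have "(\<Sum>k<N. (d k)\<^sup>2) \<le> (\<Sum>k<N. (\<epsilon> powr (- a))\<^sup>2 * (sine_coeff (Suc k) (\<alpha> - \<beta>))\<^sup>2)"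
      using d_le by (intro sum_mono) (simp flip: power_mult_distrib add: abs_le_square_iff[symmetric] abs_mult)
    then have "pi / 2 * (\<Sum>k<N. (d k)\<^sup>2) \<le>
        (\<epsilon> powr (- a))\<^sup>2 * (pi / 2 * (\<Sum>k<N. (sine_coeff (Suc k) (\<alpha> - \<beta>))\<^sup>2))"
      by (simp add: sum_distrib_left[symmetric] algebra_simps)
    also have "\<dots> \<le> (\<epsilon> powr (- a))\<^sup>2 * (norm (\<alpha> - \<beta>))\<^sup>2"
      by (intro mult_left_mono bessel) simp
    also have "\<dots> \<le> (\<epsilon> powr (- a))\<^sup>2 * \<epsilon>\<^sup>2"
      using assms by (intro mult_left_mono power_mono) auto
    finally show "pi / 2 * (\<Sum>k<N. (d k)\<^sup>2) \<le> M\<^sup>2"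
      unfolding M(2)[symmetric] power_mult_distrib .
  qed
  \<comment> \<open>The empty partial sum, N = 0.\<close>
  moreover have "0 \<le> C" using C[of 0] by simp
  have "norm E \<le> M * sqrt C"
  proof (rule norm_sine_series_le[OF E])
    show "0 \<le> M * sqrt C" using M(1) \<open>0 \<le> C\<close> by simp
    fix N
    let ?b = "\<lambda>k. exp (2 * (p + \<tau> - T) * (real (Suc k))\<^sup>2) * \<bar>sine_coeff (Suc k) w\<bar>\<^sup>2"
    have "(e k)\<^sup>2 \<le> M\<^sup>2 * ?b k" for k
    proof -
      have "(e k)\<^sup>2 \<le> (M * (exp ((p + \<tau> - T) * (real (Suc k))\<^sup>2) * \<bar>sine_coeff (Suc k) w\<bar>))\<^sup>2"
        using power_mono[OF e_le(2)[of k], of 2] by simp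
      also have "(exp ((p + \<tau> - T) * (real (Suc k))\<^sup>2))\<^sup>2 = exp (2 * (p + \<tau> - T) * (real (Suc k))\<^sup>2)"
        by (simp add: exp_double[symmetric] mult.assoc)
      then have "(M * (exp ((p + \<tau> - T) * (real (Suc k))\<^sup>2) * \<bar>sine_coeff (Suc k) w\<bar>))\<^sup>2 = M\<^sup>2 * ?b k"
        by (simp only: power_mult_distrib)
      finally show ?thesis .
    qed
    then have "(\<Sum>k<N. (e k)\<^sup>2) \<le> (\<Sum>k<N. M\<^sup>2 * ?b k)"
      by (rule sum_mono)
    then have "pi / 2 * (\<Sum>k<N. (e k)\<^sup>2) \<le> M\<^sup>2 * (pi / 2 * (\<Sum>k<N. ?b k))"
      unfolding sum_distrib_left[symmetric] by (simp add: algebra_simps)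
    also have "\<dots> \<le> M\<^sup>2 * C"
      by (intro mult_left_mono C) simp
    finally show "pi / 2 * (\<Sum>k<N. (e k)\<^sup>2) \<le> (M * sqrt C)\<^sup>2"
      using \<open>0 \<le> C\<close> by (simp add: power_mult_distrib)
  qed
  ultimately have "norm (D + E) \<le> (1 + sqrt C) * M"
    using norm_triangle_ineq[of D E] by (simp add: algebra_simps)
  then show "norm ((\<Sum>k. c k *\<^sub>R sine (Suc k)) - w) \<le> (1 + sqrt C) * \<epsilon> powr ((\<tau> - T + p) / p)"
    using sums_unique[OF sums, symmetric] by (simp add: M_def a(4))
qed

text \<open>Brings the bound on the supremum, stated in \<open>ennreal\<close> so that it includes
  convergence of the series, down to real partial sums.\<close>

lemma partial_sum_le_of_SUP:
  fixes g :: "'a \<Rightarrow> nat \<Rightarrow> real"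
  assumes "ennreal (pi / 2) * (SUP z\<in>D. \<Sum>k. ennreal (g z k)) < ennreal C"
    and "z \<in> D" and "\<And>k. 0 \<le> g z k"
  shows "pi / 2 * (\<Sum>k<N. g z k) \<le> C"
proof -
  have "ennreal (pi / 2 * (\<Sum>k<N. g z k)) = ennreal (pi / 2) * (\<Sum>k<N. ennreal (g z k))"
    using assms(3) by (simp add: ennreal_mult sum_nonneg del: times_divide_eq_left flip: sum_ennreal)
  also have "\<dots> \<le> ennreal (pi / 2) * (SUP z\<in>D. \<Sum>k. ennreal (g z k))"
    by (intro mult_left_mono order_trans[OF sum_le_suminf SUP_upper[OF assms(2)]]) auto
  also have "\<dots> \<le> ennreal C"
    using assms(1) by simp
  finally have le: "ennreal (pi / 2 * (\<Sum>k<N. g z k)) \<le> ennreal C" .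
  \<comment> \<open>\<open>ennreal\<close> sends negative numbers to 0, and nothing is strictly
    below 0.\<close>
  have "0 \<le> C"
    using assms(1) by (metis ennreal_neg not_less_zero linorder_le_cases)
  with le show ?thesis by simp
qed

text \<open>Summability accompanies each bound because \<open>suminf\<close> of a divergent series
  is an unspecified value.\<close>

theorem theorem8:
  fixes T p \<epsilon> C1 C2 :: real
    and \<phi> \<psi> \<phi>\<epsilon> \<psi>\<epsilon> :: "real \<Rightarrow> lsq"
    and f u :: "real \<times> real \<Rightarrow> lsq"
  assumes "T > 0" and "p \<ge> 1" and "T \<le> p" and "\<epsilon> > 0"
    and "C0_domA {0..T} \<phi>" and "C1_lsq {0..T} \<phi>"
    and "C0_domA {0..T} \<psi>" and "C1_lsq {0..T} \<psi>"
    and "\<phi> T = \<psi> T"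
    and "continuous_on ({0..T} \<times> {0..T}) f"
    and "C1_lsq (D1 T) f" and "C1_lsq (D2 T) f"
    and "unique_solution T f \<phi> \<psi> u"
    and "ennreal (pi / 2) * (SUP (t, s)\<in>D1 T. \<Sum>k.
           ennreal (exp (2 * (p + t - T) * (real (Suc k))\<^sup>2) * \<bar>sine_coeff (Suc k) (u (t, s))\<bar>\<^sup>2))
         < ennreal C1"
    and "ennreal (pi / 2) * (SUP (t, s)\<in>D2 T. \<Sum>k.
           ennreal (exp (2 * (p + s - T) * (real (Suc k))\<^sup>2) * \<bar>sine_coeff (Suc k) (u (t, s))\<bar>\<^sup>2))
         < ennreal C2"
    and "C0_domA {0..T} \<phi>\<epsilon>" and "C1_lsq {0..T} \<phi>\<epsilon>"
    and "C0_domA {0..T} \<psi>\<epsilon>" and "C1_lsq {0..T} \<psi>\<epsilon>"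
    and "\<forall>s\<in>{0..T}. norm (\<psi>\<epsilon> s - \<psi> s) \<le> \<epsilon>"
    and "\<forall>t\<in>{0..T}. norm (\<phi>\<epsilon> t - \<phi> t) \<le> \<epsilon>"
  shows "(\<forall>(t, s)\<in>D1 T.
            summable (\<lambda>k. reg1_term T p \<epsilon> f \<psi>\<epsilon> t s (Suc k)) \<and>
            norm (reg1 T p \<epsilon> f \<psi>\<epsilon> t s - u (t, s)) \<le> (1 + sqrt C1) * \<epsilon> powr ((t - T + p) / p)) \<and>
         (\<forall>(t, s)\<in>D2 T.
            summable (\<lambda>k. reg2_term T p \<epsilon> f \<phi>\<epsilon> t s (Suc k)) \<and>
            norm (reg2 T p \<epsilon> f \<phi>\<epsilon> t s - u (t, s)) \<le> (1 + sqrt C2) * \<epsilon> powr ((s - T + p) / p))"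
proof -
  have sol: "solution T f \<phi> \<psi> u"
    using assms(13) unfolding unique_solution_def by blast
  have dom: "\<And>t. t \<in> {0..T} \<Longrightarrow> \<phi> t \<in> domA \<and> \<psi> t \<in> domA \<and> \<phi>\<epsilon> t \<in> domA \<and> \<psi>\<epsilon> t \<in> domA"
    using assms(5,7,16,18) unfolding C0_domA_def by blast
  have u: "u (t, s) \<in> domA" "u (T, s) = \<psi> s" "u (t, T) = \<phi> t"
    if "t \<in> {0..T}" "s \<in> {0..T}" for t s
    using sol that unfolding solution_def C0_domA_def by auto
  have "summable (\<lambda>k. reg1_term T p \<epsilon> f \<psi>\<epsilon> t s (Suc k)) \<and>
      norm (reg1 T p \<epsilon> f \<psi>\<epsilon> t s - u (t, s)) \<le> (1 + sqrt C1) * \<epsilon> powr ((t - T + p) / p)"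
    if D: "(t, s) \<in> D1 T" for t s
  proof -
    have ts: "t \<in> {0..T}" "s \<in> {0..T}" "T + s - t \<in> {0..T}"
      using D by (auto simp: D1_def)
    have bound: "pi / 2 * (\<Sum>k<N. exp (2 * (p + t - T) * (real (Suc k))\<^sup>2) *
        \<bar>sine_coeff (Suc k) (u (t, s))\<bar>\<^sup>2) \<le> C1" for N
      by (rule partial_sum_le_of_SUP[where z = "(t, s)" and
            g = "\<lambda>z k. exp (2 * (p + fst z - T) * (real (Suc k))\<^sup>2) * \<bar>sine_coeff (Suc k) (u z)\<bar>\<^sup>2",
            OF assms(14)[unfolded case_prod_unfold prod.collapse] D, unfolded prod.sel])
        simp
    \<comment> \<open>In the lower triangle the characteristic through (t, s) reaches the side where
      the first time is T, at second time T + s - t; there u equals \<psi>.\<close>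
    have duhamel: "integral {t..T} (\<lambda>\<eta>. exp ((t - \<eta>) * (real n)\<^sup>2) * sine_coeff n (f (T + t - \<eta>, T + s - \<eta>))) =
        sine_coeff n (\<psi> (T + s - t)) - exp ((t - T) * (real n)\<^sup>2) * sine_coeff n (u (t, s))" for n
      using sine_coeff_duhamel[OF sol assms(1), of t t s n] u(2)[OF ts(1,3)] D
      by (auto simp: D1_def)
    define c where "c k = (\<epsilon> + exp (- p * (real (Suc k))\<^sup>2)) powr ((t - T) / p) *
      (sine_coeff (Suc k) (\<psi>\<epsilon> (T + s - t)) - sine_coeff (Suc k) (\<psi> (T + s - t))
        + exp ((t - T) * (real (Suc k))\<^sup>2) * sine_coeff (Suc k) (u (t, s)))" for k
    \<comment> \<open>The Duhamel identity replaces the integral by boundary and interior values of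
      u, which turns the bracket into data difference plus damped coefficient.\<close>
    have reg: "reg1_term T p \<epsilon> f \<psi>\<epsilon> t s (Suc k) = c k *\<^sub>R sine (Suc k)" for k
      unfolding reg1_term_def c_def duhamel by (simp only: diff_diff_eq2 diff_add_eq)
    have "0 < p" "t \<le> T" "T - t \<le> p"
      using assms(2,3) ts by auto
    moreover have "\<psi>\<epsilon> (T + s - t) \<in> domA" "\<psi> (T + s - t) \<in> domA" "u (t, s) \<in> domA"
      "norm (\<psi>\<epsilon> (T + s - t) - \<psi> (T + s - t)) \<le> \<epsilon>"
      using dom u(1) assms(20) ts by blast+
    ultimately show ?thesis
      unfolding reg1_def reg
      using regularized_series_estimate[OF _ assms(4) _ _ _ _ _ _ bound c_def] by blast
  qed
  \<comment> \<open>Mirror image: the characteristic now meets the side where the second time is T,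
    and u equals \<phi> there.\<close>
  moreover have "summable (\<lambda>k. reg2_term T p \<epsilon> f \<phi>\<epsilon> t s (Suc k)) \<and>
      norm (reg2 T p \<epsilon> f \<phi>\<epsilon> t s - u (t, s)) \<le> (1 + sqrt C2) * \<epsilon> powr ((s - T + p) / p)"
    if D: "(t, s) \<in> D2 T" for t s
  proof -
    have ts: "t \<in> {0..T}" "s \<in> {0..T}" "T + t - s \<in> {0..T}"
      using D by (auto simp: D2_def)
    have bound: "pi / 2 * (\<Sum>k<N. exp (2 * (p + s - T) * (real (Suc k))\<^sup>2) *
        \<bar>sine_coeff (Suc k) (u (t, s))\<bar>\<^sup>2) \<le> C2" for N
      by (rule partial_sum_le_of_SUP[where z = "(t, s)" and
            g = "\<lambda>z k. exp (2 * (p + snd z - T) * (real (Suc k))\<^sup>2) * \<bar>sine_coeff (Suc k) (u z)\<bar>\<^sup>2",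
            OF assms(15)[unfolded case_prod_unfold prod.collapse] D, unfolded prod.sel])
        simp
    have duhamel: "integral {s..T} (\<lambda>\<eta>. exp ((s - \<eta>) * (real n)\<^sup>2) * sine_coeff n (f (T + t - \<eta>, T + s - \<eta>))) =
        sine_coeff n (\<phi> (T + t - s)) - exp ((s - T) * (real n)\<^sup>2) * sine_coeff n (u (t, s))" for n
      using sine_coeff_duhamel[OF sol assms(1), of s t s n] u(3)[OF ts(3,2)] D
      by (auto simp: D2_def)
    define c where "c k = (\<epsilon> + exp (- p * (real (Suc k))\<^sup>2)) powr ((s - T) / p) *
      (sine_coeff (Suc k) (\<phi>\<epsilon> (T + t - s)) - sine_coeff (Suc k) (\<phi> (T + t - s))
        + exp ((s - T) * (real (Suc k))\<^sup>2) * sine_coeff (Suc k) (u (t, s)))" for k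
    have reg: "reg2_term T p \<epsilon> f \<phi>\<epsilon> t s (Suc k) = c k *\<^sub>R sine (Suc k)" for k
      unfolding reg2_term_def c_def duhamel by (simp only: diff_diff_eq2 diff_add_eq)
    have "0 < p" "s \<le> T" "T - s \<le> p"
      using assms(2,3) ts by auto
    moreover have "\<phi>\<epsilon> (T + t - s) \<in> domA" "\<phi> (T + t - s) \<in> domA" "u (t, s) \<in> domA"
      "norm (\<phi>\<epsilon> (T + t - s) - \<phi> (T + t - s)) \<le> \<epsilon>"
      using dom u(1) assms(21) ts by blast+
    ultimately show ?thesis
      unfolding reg2_def reg
      using regularized_series_estimate[OF _ assms(4) _ _ _ _ _ _ bound c_def] by blast
  qed
  ultimately show ?thesis
    by (intro conjI ballI case_prodI2) blast+
qed

end
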